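(* Let $\alpha\in(0,1]$, $n\in\mathbb{N}$, $\rho_0\in\mathbb{R}$, $y_0\in\mathbb{C}^n$, and let $f:\mathbb{R}_{>0}\times\mathbb{C}^n\to\mathbb{C}^n$ be continuous with $|f(t,y_1)-f(t,y_2)|\leq c|y_1-y_2|$ for some $c\geq0$ and all $y_1,y_2\in\mathbb{C}^n$, $t>0$, and $(t\mapsto f(t,0))\in L^2_{\rho_0}(\mathbb{R}_{>0};\mathbb{C}^n)$. Let $\tilde f(t,y):=\chi_{\mathbb{R}_{>0}}(t)f(t,y)$ for $t\in\mathbb{R}$, $y\in\mathbb{C}^n$ (with $\tilde f(t,y)=0$ for $t\leq0$). Let $\rho>\max\{0,\rho_0\}$ and $y\in L^2_\rho(\mathbb{R};\mathbb{C}^n)$. Then the following are equivalent: (i) $y(t)=y_0\chi_{\mathbb{R}_{>0}}(t)+\frac{1}{\Gamma(\alpha)}\int_{-\infty}^t(t-s)^{\alpha-1}\tilde f(s,y(s))\,ds$ for almost every $t\in\mathbb{R}$; (ii) $y=\partial^{-\alpha}_{0,\rho}\tilde f(\cdot,y(\cdot))+y_0\chi_{\mathbb{R}_{>0}}$; (iii) $\partial^\alpha_{0,\rho}(y-y_0\chi_{\mathbb{R}_{>0}})=\tilde f(\cdot,y(\cdot))$.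
   Context: $\chi_{\mathbb{R}_{>0}}$ is the indicator of $(0,\infty)$. $L^2_\rho(\mathbb{R};\mathbb{C}^n)$ is the space of measurable $g$ with $\int|g(t)|^2e^{-2\rho t}dt<\infty$. $\mathcal{L}_\rho:L^2_\rho(\mathbb{R};\mathbb{C}^n)\to L^2(\mathbb{R};\mathbb{C}^n)$ is the unitary Fourier–Laplace transform, $(\mathcal{L}_\rho g)(\xi)=(2\pi)^{-1/2}\int e^{-(i\xi+\rho)t}g(t)dt$ for suitable $g$ (extended by continuity). For $\gamma\in\mathbb{R}$, $\partial^\gamma_{0,\rho}:=\mathcal{L}_\rho^*(im+\rho)^\gamma\mathcal{L}_\rho$ with maximal domain, where $((im+\rho)^\gamma h)(\xi)=(i\xi+\rho)^\gamma h(\xi)$ (principal branch), defined for those $h\in L^2$ for which the result lies in $L^2$. For these $\rho$, $y\mapsto\tilde f(\cdot,y(\cdot))$ maps $L^2_\rho(\mathbb{R};\mathbb{C}^n)$ into itself. *)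

theory Defs
  imports "HOL-Analysis.Analysis"
begin

definition cscale :: "complex \<Rightarrow> complex ^ 'n \<Rightarrow> complex ^ 'n" where
  "cscale c v = (\<chi> k. c * v $ k)"

definition L2rho :: "real \<Rightarrow> (real \<Rightarrow> complex ^ 'n) \<Rightarrow> bool" where
  "L2rho rho g \<longleftrightarrow> g \<in> borel_measurable lborel \<and>
     integrable lborel (\<lambda>t. (norm (g t))\<^sup>2 * exp (-2 * rho * t))"

definition FL_trunc :: "real \<Rightarrow> (real \<Rightarrow> complex ^ 'n) \<Rightarrow> real \<Rightarrow> real \<Rightarrow> complex ^ 'n" where
  "FL_trunc rho g R xi = (\<chi> k. complex_of_real (1 / sqrt (2 * pi)) *
      (LINT t:{-R..R}|lborel. exp (- (Complex rho xi) * complex_of_real t) * g t $ k))"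

text \<open>h is the (unitary) Fourier-Laplace transform of g: the L^2 limit of the transforms of the
  truncations (this is the extension by continuity).\<close>
definition is_FL :: "real \<Rightarrow> (real \<Rightarrow> complex ^ 'n) \<Rightarrow> (real \<Rightarrow> complex ^ 'n) \<Rightarrow> bool" where
  "is_FL rho g h \<longleftrightarrow> L2rho rho g \<and> h \<in> borel_measurable lborel \<and>
     ((\<lambda>R. \<integral>\<^sup>+ xi. ennreal ((norm (FL_trunc rho g R xi - h xi))\<^sup>2) \<partial>lborel) \<longlongrightarrow> 0) at_top"

definition FLinv_trunc :: "real \<Rightarrow> (real \<Rightarrow> complex ^ 'n) \<Rightarrow> real \<Rightarrow> real \<Rightarrow> complex ^ 'n" where
  "FLinv_trunc rho h R t = (\<chi> k. complex_of_real (1 / sqrt (2 * pi)) *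
      (LINT xi:{-R..R}|lborel. exp (Complex rho xi * complex_of_real t) * h xi $ k))"

definition is_FLadj :: "real \<Rightarrow> (real \<Rightarrow> complex ^ 'n) \<Rightarrow> (real \<Rightarrow> complex ^ 'n) \<Rightarrow> bool" where
  "is_FLadj rho h u \<longleftrightarrow> h \<in> borel_measurable lborel \<and>
     integrable lborel (\<lambda>xi. (norm (h xi))\<^sup>2) \<and> u \<in> borel_measurable lborel \<and>
     ((\<lambda>R. \<integral>\<^sup>+ t. ennreal ((norm (FLinv_trunc rho h R t - u t))\<^sup>2 * exp (-2 * rho * t)) \<partial>lborel)
        \<longlongrightarrow> 0) at_top"

text \<open>frac_deriv rho gam g u: g lies in the (maximal) domain of
  partial^gam_{0,rho} = L_rho^* (im+rho)^gam L_rho, and u = partial^gam_{0,rho} g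
  (as elements of L^2_rho, i.e. up to null sets). Principal branch via complex powr.\<close>
definition frac_deriv :: "real \<Rightarrow> real \<Rightarrow> (real \<Rightarrow> complex ^ 'n) \<Rightarrow> (real \<Rightarrow> complex ^ 'n) \<Rightarrow> bool" where
  "frac_deriv rho gam g u \<longleftrightarrow> (\<exists>h. is_FL rho g h \<and>
     is_FLadj rho (\<lambda>xi. cscale ((Complex rho xi) powr (complex_of_real gam)) (h xi)) u)"

definition ftilde :: "(real \<Rightarrow> complex ^ 'n \<Rightarrow> complex ^ 'n) \<Rightarrow> real \<Rightarrow> complex ^ 'n \<Rightarrow> complex ^ 'n" where
  "ftilde f t x = (if t > 0 then f t x else 0)"

end

(*
  After multiplication by exp (- rho t) the operator partial^gamma becomes the multiplication by
  (rho + i xi)^gamma on the Fourier side of L^2(R), componentwise, so only the unitary Fourier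
  transform of scalar functions is needed.  On the intersection of L^1 and L^2 it is contractive
  (Gaussian regularisation, multiplication formula, Young's inequality), hence extends to L^2 by
  completeness; inversion is checked on bounded continuous functions, where it reduces to the
  pointwise convergence of Gaussian averages, and extended by density.  The function
  t^(alpha-1) exp (- rho t) / Gamma(alpha) on t > 0 is integrable with Fourier-Laplace transform
  (rho + i xi)^(-alpha), so by the convolution theorem partial^(-alpha) is the Riemann-Liouville
  integral, which is (i) <-> (ii); and partial^alpha and partial^(-alpha) are inverse relations by
  Fourier inversion, which is (ii) <-> (iii).
*)

theory Submission
  imports Defs "HOL-Probability.Characteristic_Functions"
begin

section \<open>The square integral of a scalar function\<close>

text \<open>The contraction estimate comes from a special choice in the multiplication formula: for
  G in L^1 and L^2 its second function is the conjugate of the Gaussian-damped transform of G. One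
  side becomes the damped energy of the transform, the other the inner product of G with G smoothed
  by a density of mass one, hence at most the energy of G. Fatou's lemma removes the damping. From
  there on bounds with unsharp constants suffice, since they are applied to differences that tend to
  zero or vanish. What shapes the rest is that an L^2 transform is a limit of truncated integrals
  and is determined only almost everywhere. It is therefore a relation \<open>L2_FT G H\<close>
  instead of a function, and inversion is a symmetry of this relation: it holds exactly when H is
  related to the reflection of G. The transform and its adjoint are then instances of one relation,
  and membership in the maximal domain of a fractional power amounts, in each component, to two
  instances of it with a common Fourier side.\<close>

definition energy :: "(real \<Rightarrow> complex) \<Rightarrow> ennreal" where
  "energy g = (\<integral>\<^sup>+ x. ennreal ((norm (g x))\<^sup>2) \<partial>lborel)"

lemma energy_cong_AE:
  "AE x in lborel. g x = g' x \<Longrightarrow> energy g = energy g'"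
  unfolding energy_def by (rule nn_integral_cong_AE) auto

lemma norm_power2_sum_le:
  fixes a b :: "'a::real_normed_vector"
  shows "(norm (a + b))\<^sup>2 \<le> 2 * (norm a)\<^sup>2 + 2 * (norm b)\<^sup>2"
proof -
  have "(norm (a + b))\<^sup>2 \<le> (norm a + norm b)\<^sup>2"
    by (intro power_mono norm_triangle_ineq norm_ge_zero)
  also have "\<dots> \<le> 2 * (norm a)\<^sup>2 + 2 * (norm b)\<^sup>2"
    using zero_le_power2[of "norm a - norm b"] by (simp add: power2_eq_square algebra_simps)
  finally show ?thesis .
qed

lemma energy_add_le:
  assumes [measurable]: "f \<in> borel_measurable borel" "g \<in> borel_measurable borel"
  shows "energy (\<lambda>x. f x + g x) \<le> 2 * energy f + 2 * energy g"
proof -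
  have "energy (\<lambda>x. f x + g x)
      \<le> (\<integral>\<^sup>+ x. 2 * ennreal ((norm (f x))\<^sup>2) + 2 * ennreal ((norm (g x))\<^sup>2) \<partial>lborel)"
    unfolding energy_def
  proof (rule nn_integral_mono)
    fix x
    have "ennreal ((norm (f x + g x))\<^sup>2) \<le> ennreal (2 * (norm (f x))\<^sup>2 + 2 * (norm (g x))\<^sup>2)"
      by (intro ennreal_leI norm_power2_sum_le)
    then show "ennreal ((norm (f x + g x))\<^sup>2)
        \<le> 2 * ennreal ((norm (f x))\<^sup>2) + 2 * ennreal ((norm (g x))\<^sup>2)"
      by (simp add: ennreal_mult)
  qed
  also have "\<dots> = 2 * energy f + 2 * energy g"
    unfolding energy_def by (subst nn_integral_add) (auto simp: nn_integral_cmult)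
  finally show ?thesis .
qed

lemma energy_uminus [simp]: "energy (\<lambda>x. - g x) = energy g"
  by (simp add: energy_def)

lemma energy_cmult: 
  assumes [measurable]: "g \<in> borel_measurable borel"
  shows "energy (\<lambda>x. c * g x) = ennreal ((norm c)\<^sup>2) * energy g"
  by (simp add: energy_def norm_mult power_mult_distrib ennreal_mult nn_integral_cmult)

lemma energy_mono:
  "(\<And>x. norm (f x) \<le> norm (g x)) \<Longrightarrow> energy f \<le> energy g"
  unfolding energy_def by (intro nn_integral_mono ennreal_leI power_mono) auto

lemma energy_diff_commute: "energy (\<lambda>x. f x - g x) = energy (\<lambda>x. g x - f x)"
  by (simp add: energy_def norm_minus_commute)

text \<open>The energy is the square of the norm; a quasi-triangle inequality for it is all that the limit
  arguments need, so that no square roots of extended reals occur.\<close>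

lemma energy_triangle:
  assumes [measurable]: "f \<in> borel_measurable borel" "g \<in> borel_measurable borel"
    "h \<in> borel_measurable borel"
  shows "energy (\<lambda>x. f x - h x) \<le> 2 * energy (\<lambda>x. f x - g x) + 2 * energy (\<lambda>x. g x - h x)"
  using energy_add_le[of "\<lambda>x. f x - g x" "\<lambda>x. g x - h x"] by simp

lemma energy_eq_0_iff:
  assumes [measurable]: "g \<in> borel_measurable borel"
  shows "energy g = 0 \<longleftrightarrow> (AE x in lborel. g x = 0)"
  unfolding energy_def by (subst nn_integral_0_iff_AE) (auto simp: ennreal_eq_0_iff)

lemma energy_reflect:
  assumes [measurable]: "g \<in> borel_measurable borel"
  shows "energy (\<lambda>x. g (- x)) = energy g"
  unfolding energy_def
  by (subst (2) nn_integral_real_affine[where c="-1" and t=0]) auto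

lemma energy_finite_iff:
  assumes [measurable]: "g \<in> borel_measurable borel"
  shows "energy g < \<infinity> \<longleftrightarrow> integrable lborel (\<lambda>x. (norm (g x))\<^sup>2)"
  by (simp add: energy_def integrable_iff_bounded)

section \<open>Fatou's lemma, dominated convergence and completeness in mean square\<close>

lemma energy_limit_le:
  assumes [measurable]: "\<And>n. f n \<in> borel_measurable borel" "g \<in> borel_measurable borel"
      "h \<in> borel_measurable borel"
    and lim: "AE x in lborel. (\<lambda>n. f n x) \<longlonglongrightarrow> g x"
  shows "energy (\<lambda>x. g x - h x) \<le> liminf (\<lambda>n. energy (\<lambda>x. f n x - h x))"
proof -
  have "energy (\<lambda>x. g x - h x)
      = (\<integral>\<^sup>+ x. liminf (\<lambda>n. ennreal ((norm (f n x - h x))\<^sup>2)) \<partial>lborel)"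
    unfolding energy_def
  proof (rule nn_integral_cong_AE, use lim in eventually_elim)
    case (elim x)
    have "(\<lambda>n. ennreal ((norm (f n x - h x))\<^sup>2)) \<longlonglongrightarrow> ennreal ((norm (g x - h x))\<^sup>2)"
      by (intro tendsto_intros tendsto_ennrealI elim)
    then show ?case
      using lim_imp_Liminf[OF trivial_limit_sequentially] by fastforce
  qed
  also have "\<dots> \<le> liminf (\<lambda>n. energy (\<lambda>x. f n x - h x))"
    unfolding energy_def by (rule nn_integral_liminf) auto
  finally show ?thesis .
qed

text \<open>By Fatou, the energy of g - h is at most the lower limit of the energies of f n - h,
  which is 0. This identifies a mean-square limit with a pointwise one.\<close>

lemma pointwise_limit_eq_energy_limit:
  assumes [measurable]: "\<And>n. f n \<in> borel_measurable borel" "g \<in> borel_measurable borel"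
      "h \<in> borel_measurable borel"
    and lim: "AE x in lborel. (\<lambda>n. f n x) \<longlonglongrightarrow> g x"
    and en: "(\<lambda>n. energy (\<lambda>x. f n x - h x)) \<longlonglongrightarrow> 0"
  shows "AE x in lborel. g x = h x"
proof -
  have "energy (\<lambda>x. g x - h x) \<le> 0"
    using energy_limit_le[of f g h] lim lim_imp_Liminf[OF trivial_limit_sequentially en] by auto
  then show ?thesis using energy_eq_0_iff[of "\<lambda>x. g x - h x"] by auto
qed

text \<open>The pointwise limit inherits the bound by d, so the squared differences are at most 2
  |d|^2 + 2 |d|^2, whence the majorant 4 |d|^2.\<close>

lemma energy_dominated_convergence:
  assumes [measurable]: "\<And>n. f n \<in> borel_measurable borel" "g \<in> borel_measurable borel"
      "d \<in> borel_measurable borel"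
    and lim: "AE x in lborel. (\<lambda>n. f n x) \<longlonglongrightarrow> g x"
    and bound: "\<And>n. AE x in lborel. norm (f n x) \<le> norm (d x)"
    and d: "energy d < \<infinity>"
  shows "(\<lambda>n. energy (\<lambda>x. f n x - g x)) \<longlonglongrightarrow> 0"
proof -
  have g_le: "AE x in lborel. norm (g x) \<le> norm (d x)"
  proof -
    have "AE x in lborel. \<forall>n. norm (f n x) \<le> norm (d x)"
      using bound by (simp add: AE_all_countable)
    with lim show ?thesis
    proof eventually_elim
      case (elim x)
      then show ?case
        by (intro tendsto_upperbound[OF tendsto_norm, of "\<lambda>n. f n x"]) auto
    qed
  qed
  have "(\<lambda>n. energy (\<lambda>x. f n x - g x)) \<longlonglongrightarrow> (\<integral>\<^sup>+ x. 0 \<partial>(lborel :: real measure))"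
    unfolding energy_def
  proof (rule nn_integral_dominated_convergence[where w="\<lambda>x. 4 * ennreal ((norm (d x))\<^sup>2)"])
    fix n
    show "AE x in lborel. ennreal ((norm (f n x - g x))\<^sup>2) \<le> 4 * ennreal ((norm (d x))\<^sup>2)"
      using bound[of n] g_le
    proof eventually_elim
      case (elim x)
      have "(norm (f n x - g x))\<^sup>2 \<le> 2 * (norm (f n x))\<^sup>2 + 2 * (norm (g x))\<^sup>2"
        using norm_power2_sum_le[of "f n x" "- g x"] by simp
      also have "\<dots> \<le> 2 * (norm (d x))\<^sup>2 + 2 * (norm (d x))\<^sup>2"
        using elim by (intro add_mono mult_left_mono power_mono) auto
      finally have "ennreal ((norm (f n x - g x))\<^sup>2) \<le> ennreal (4 * (norm (d x))\<^sup>2)"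
        by (intro ennreal_leI) simp
      then show ?case by (simp add: ennreal_mult)
    qed
  next
    show "AE x in lborel. (\<lambda>n. ennreal ((norm (f n x - g x))\<^sup>2)) \<longlonglongrightarrow> 0"
      using lim
    proof eventually_elim
      case (elim x)
      have "(\<lambda>n. ennreal ((norm (f n x - g x))\<^sup>2)) \<longlonglongrightarrow> ennreal ((norm (g x - g x))\<^sup>2)"
        by (intro tendsto_intros tendsto_ennrealI elim)
      then show ?case by simp
    qed
  next
    show "(\<integral>\<^sup>+ x. 4 * ennreal ((norm (d x))\<^sup>2) \<partial>lborel) < \<infinity>"
      using d by (simp add: nn_integral_cmult energy_def ennreal_mult_less_top)
  qed auto
  then show ?thesis by simp
qed

text \<open>Since (2^k d - 1)^2 is nonnegative, d \<le> 2^k d^2 + 2^(-k): geometrically weighted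
  squares control the increments themselves, and the sequence telescopes.\<close>

lemma convergent_of_weighted_square_sum:
  fixes u :: "nat \<Rightarrow> complex"
  assumes "(\<Sum>k. ennreal (2 ^ k * (norm (u (Suc k) - u k))\<^sup>2)) \<noteq> \<infinity>"
  shows "convergent u"
proof -
  have "summable (\<lambda>k. 2 ^ k * (norm (u (Suc k) - u k))\<^sup>2)"
    using assms by (intro summable_suminf_not_top) auto
  moreover have "summable (\<lambda>k. (1 / 2) ^ k :: real)"
    by (intro summable_geometric) auto
  ultimately have s: "summable (\<lambda>k. 2 ^ k * (norm (u (Suc k) - u k))\<^sup>2 + (1 / 2) ^ k)"
    by (rule summable_add)
  have "norm (u (Suc k) - u k) \<le> 2 ^ k * (norm (u (Suc k) - u k))\<^sup>2 + (1 / 2) ^ k" for k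
  proof -
    define d where "d = norm (u (Suc k) - u k)"
    have "0 \<le> (2 ^ k * d - 1)\<^sup>2" "0 \<le> 2 ^ k * d" by (auto simp: d_def)
    then have "2 ^ k * d \<le> (2 ^ k * d)\<^sup>2 + 1" 
      unfolding power2_diff by (simp add: algebra_simps)
    then have "d \<le> ((2 ^ k * d)\<^sup>2 + 1) / 2 ^ k"
      by (simp add: field_simps)
    also have "\<dots> = 2 ^ k * d\<^sup>2 + (1 / 2) ^ k"
      by (simp add: field_simps power2_eq_square power_one_over)
    finally show ?thesis by (simp add: d_def)
  qed
  then have "summable (\<lambda>k. u (Suc k) - u k)"
    by (intro summable_comparison_test[OF _ s]) auto
  then have "convergent (\<lambda>n. \<Sum>k<n. u (Suc k) - u k)"
    by (simp add: summable_iff_convergent)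
  then have "convergent (\<lambda>n. u n - u 0)"
    by (simp add: sum_lessThan_telescope)
  then show ?thesis
    using convergent_add[OF _ convergent_const[of "u 0"], of "\<lambda>n. u n - u 0"] by simp
qed

text \<open>The Riesz-Fischer argument: a rapidly converging subsequence converges almost
  everywhere, and Fatou shows that its limit is the mean-square limit of the whole sequence.\<close>

lemma energy_complete:
  assumes [measurable]: "\<And>n. f n \<in> borel_measurable borel"
    and cauchy: "\<And>e. e > 0 \<Longrightarrow> \<exists>N. \<forall>m\<ge>N. \<forall>n\<ge>N. energy (\<lambda>x. f m x - f n x) \<le> ennreal e"
  shows "\<exists>g \<in> borel_measurable borel. (\<lambda>n. energy (\<lambda>x. f n x - g x)) \<longlonglongrightarrow> 0"
proof -
  \<comment> \<open>The rate (1/4)^k is chosen against the weight 2^k of the telescoping criterion: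
    the product (1/2)^k is summable.\<close>
  have "\<exists>N. \<forall>m\<ge>N. \<forall>n\<ge>N. energy (\<lambda>x. f m x - f n x) \<le> ennreal ((1/4) ^ k)" for k
    by (rule cauchy) simp
  then obtain N where N: "\<And>k m n. m \<ge> N k \<Longrightarrow> n \<ge> N k \<Longrightarrow>
      energy (\<lambda>x. f m x - f n x) \<le> ennreal ((1/4) ^ k)"
    by metis
  \<comment> \<open>One formula makes the index at least N k, at least k, and nondecreasing.\<close>
  define r where "r k = k + (\<Sum>j\<le>k. N j)" for k
  have rN: "N k \<le> r k" for k
    unfolding r_def by (rule order_trans[OF member_le_sum[of k "{..k}" N]]) auto
  have rk: "k \<le> r k" for k by (simp add: r_def)
  have rS: "r k \<le> r (Suc k)" for k by (simp add: r_def)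
  define g where "g x = lim (\<lambda>k. f (r k) x)" for x
  have [measurable]: "g \<in> borel_measurable borel"
    unfolding g_def by measurable
  have "(\<integral>\<^sup>+ x. (\<Sum>k. ennreal (2 ^ k * (norm (f (r (Suc k)) x - f (r k) x))\<^sup>2)) \<partial>lborel)
      = (\<Sum>k. 2 ^ k * energy (\<lambda>x. f (r (Suc k)) x - f (r k) x))"
    by (subst nn_integral_suminf)
      (auto simp: energy_def ennreal_mult nn_integral_cmult ennreal_power[symmetric])
  also have "\<dots> \<le> (\<Sum>k. ennreal ((1/2) ^ k))"
  proof (intro suminf_le allI)
    fix k
    have "energy (\<lambda>x. f (r (Suc k)) x - f (r k) x) \<le> ennreal ((1/4) ^ k)"
      using rN[of k] rS[of k] by (intro N) auto
    then have "2 ^ k * energy (\<lambda>x. f (r (Suc k)) x - f (r k) x) \<le> 2 ^ k * ennreal ((1/4) ^ k)"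
      by (intro mult_left_mono) auto
    also have "\<dots> = ennreal (2 ^ k * (1/4) ^ k)"
      by (simp add: ennreal_mult ennreal_power[symmetric])
    also have "(2::real) ^ k * (1/4) ^ k = (1/2) ^ k"
      by (simp add: power_mult_distrib[symmetric])
    finally show "2 ^ k * energy (\<lambda>x. f (r (Suc k)) x - f (r k) x) \<le> ennreal ((1/2) ^ k)" .
  qed auto
  also have "\<dots> < \<infinity>"
    by (subst suminf_ennreal2) (auto intro: summable_geometric)
  finally have "AE x in lborel. (\<Sum>k. ennreal (2 ^ k * (norm (f (r (Suc k)) x - f (r k) x))\<^sup>2)) \<noteq> \<infinity>"
    by (intro nn_integral_PInf_AE) auto
  then have lim: "AE x in lborel. (\<lambda>k. f (r k) x) \<longlonglongrightarrow> g x"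
  proof eventually_elim
    case (elim x)
    then show ?case
      unfolding g_def using convergent_of_weighted_square_sum[of "\<lambda>k. f (r k) x"]
      by (simp add: convergent_LIMSEQ_iff)
  qed
  have "(\<lambda>n. energy (\<lambda>x. f n x - g x)) \<longlonglongrightarrow> 0"
  proof (rule order_tendstoI)
    fix a :: ennreal assume "0 < a"
    then obtain b where b: "0 < b" "b < a" using dense by blast
    then have "b < top" by (meson order.strict_trans2 top_greatest)
    with b have e: "enn2real b > 0" "ennreal (enn2real b) < a"
      by (simp_all add: enn2real_positive_iff)
    define e where "e = enn2real b"
    note e = e[folded e_def]
    from cauchy[OF e(1)] obtain M where
      M: "\<And>m n. m \<ge> M \<Longrightarrow> n \<ge> M \<Longrightarrow> energy (\<lambda>x. f m x - f n x) \<le> ennreal e"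
      by blast
    have "energy (\<lambda>x. f n x - g x) < a" if "n \<ge> M" for n
    proof -
      \<comment> \<open>With n fixed, Fatou along the subsequence turns the Cauchy bound into a
        bound on the distance to the limit.\<close>
      have "energy (\<lambda>x. g x - f n x) \<le> liminf (\<lambda>k. energy (\<lambda>x. f (r k) x - f n x))"
        by (rule energy_limit_le) (use lim in auto)
      also have "\<dots> \<le> limsup (\<lambda>k. energy (\<lambda>x. f (r k) x - f n x))"
        by (intro Liminf_le_Limsup) auto
      also have "\<dots> \<le> ennreal e"
      proof (rule Limsup_bounded, unfold eventually_sequentially, intro exI[of _ M] allI impI)
        fix k assume "k \<ge> M"
        then show "energy (\<lambda>x. f (r k) x - f n x) \<le> ennreal e"
          using rk[of k] that by (intro M) auto
      qed
      finally show ?thesis using e(2) by (simp add: energy_diff_commute[of g])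
    qed
    then show "\<forall>\<^sub>F n in sequentially. energy (\<lambda>x. f n x - g x) < a"
      unfolding eventually_sequentially by blast
  qed simp
  then show ?thesis by (intro bexI[of _ g]) auto
qed

section \<open>Convolutions and the Fourier transform of integrable functions\<close>

lemma lborel_Fubini:
  fixes f :: "real \<Rightarrow> real \<Rightarrow> complex"
  assumes [measurable]: "(\<lambda>(x, y). f x y) \<in> borel_measurable (lborel \<Otimes>\<^sub>M lborel)"
    and fin: "(\<integral>\<^sup>+ x. \<integral>\<^sup>+ y. ennreal (norm (f x y)) \<partial>lborel \<partial>lborel) < \<infinity>"
  shows "(\<integral>x. \<integral>y. f x y \<partial>lborel \<partial>lborel) = (\<integral>y. \<integral>x. f x y \<partial>lborel \<partial>lborel)"
proof -
  have "integrable (lborel \<Otimes>\<^sub>M lborel) (\<lambda>(x, y). f x y)"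
  proof (rule integrableI_bounded)
    have "(\<integral>\<^sup>+ p. ennreal (norm (case p of (x, y) \<Rightarrow> f x y)) \<partial>(lborel \<Otimes>\<^sub>M lborel))
        = (\<integral>\<^sup>+ x. \<integral>\<^sup>+ y. ennreal (norm (f x y)) \<partial>lborel \<partial>lborel)"
      by (subst lborel.nn_integral_fst[symmetric]) (auto simp: case_prod_beta)
    with fin show "(\<integral>\<^sup>+ p. ennreal (norm (case p of (x, y) \<Rightarrow> f x y)) \<partial>(lborel \<Otimes>\<^sub>M lborel)) < \<infinity>"
      by simp
  qed measurable
  from lborel_pair.Fubini_integral[OF this] show ?thesis by simp
qed

lemma nn_integral_reflect_shift:
  fixes K :: "real \<Rightarrow> ennreal"
  assumes [measurable]: "K \<in> borel_measurable borel"
  shows "(\<integral>\<^sup>+ s. K (t - s) \<partial>lborel) = (\<integral>\<^sup>+ s. K s \<partial>lborel)"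
    and "(\<integral>\<^sup>+ s. K (s - t) \<partial>lborel) = (\<integral>\<^sup>+ s. K s \<partial>lborel)"
  using nn_integral_real_affine[of K "-1" t] nn_integral_real_affine[of K 1 "-t"]
  by simp_all

section \<open>Convolution with a nonnegative integrable kernel\<close>

definition convolve :: "(real \<Rightarrow> real) \<Rightarrow> (real \<Rightarrow> complex) \<Rightarrow> real \<Rightarrow> complex" where
  "convolve K G t = (\<integral>s. of_real (K (t - s)) * G s \<partial>lborel)"

lemma borel_measurable_convolve [measurable]:
  assumes [measurable]: "K \<in> borel_measurable borel" "G \<in> borel_measurable borel"
  shows "convolve K G \<in> borel_measurable borel"
  unfolding convolve_def by measurable

text \<open>Both the normal densities and the kernel of the fractional integral are instances.
  Nonnegativity makes the L^1 norm of the kernel equal to its integral.\<close>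

locale convolution_kernel =
  fixes K :: "real \<Rightarrow> real"
  assumes integrable_kernel: "integrable lborel K" and kernel_nonneg: "\<And>t. 0 \<le> K t"
begin

lemma borel_measurable_kernel [measurable]: "K \<in> borel_measurable borel"
  using integrable_kernel by auto

lemma nn_integral_kernel:
  "(\<integral>\<^sup>+ s. ennreal (K (t - s)) \<partial>lborel) = ennreal (\<integral>s. K s \<partial>lborel)"
  "(\<integral>\<^sup>+ s. ennreal (K (s - t)) \<partial>lborel) = ennreal (\<integral>s. K s \<partial>lborel)"
  using nn_integral_reflect_shift[of "\<lambda>s. ennreal (K s)" t]
  by (simp_all add: nn_integral_eq_integral integrable_kernel kernel_nonneg)

lemma nn_integral_convolve:
  assumes [measurable]: "h \<in> borel_measurable borel"
  shows "(\<integral>\<^sup>+ t. \<integral>\<^sup>+ s. ennreal (K (t - s)) * h s \<partial>lborel \<partial>lborel)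
    = ennreal (\<integral>s. K s \<partial>lborel) * (\<integral>\<^sup>+ s. h s \<partial>lborel)"
  by (subst lborel_pair.Fubini')
    (auto simp: nn_integral_multc nn_integral_kernel nn_integral_cmult)

text \<open>Young's inequality for L^1 and L^2: write K as sqrt K times sqrt K, apply Cauchy-Schwarz
  in s, then Tonelli. The norm stays inside the inner integral so that absolute convergence can be
  read off as well.\<close>

lemma nn_integral_convolve_power2:
  assumes [measurable]: "G \<in> borel_measurable borel"
  shows "(\<integral>\<^sup>+ t. (\<integral>\<^sup>+ s. ennreal (norm (of_real (K (t - s)) * G s)) \<partial>lborel)\<^sup>2 \<partial>lborel)
    \<le> ennreal ((\<integral>s. K s \<partial>lborel)\<^sup>2) * energy G"
proof -
  have "(\<integral>\<^sup>+ s. ennreal (norm (of_real (K (t - s)) * G s)) \<partial>lborel)\<^sup>2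
      \<le> ennreal (\<integral>s. K s \<partial>lborel) * (\<integral>\<^sup>+ s. ennreal (K (t - s)) * ennreal ((norm (G s))\<^sup>2) \<partial>lborel)"
    for t
  proof -
    have "(\<integral>\<^sup>+ s. ennreal (norm (of_real (K (t - s)) * G s)) \<partial>lborel)
      = (\<integral>\<^sup>+ s. ennreal (sqrt (K (t - s))) * ennreal (sqrt (K (t - s)) * norm (G s)) \<partial>lborel)"
      by (intro nn_integral_cong)
        (simp add: ennreal_mult[symmetric] norm_mult kernel_nonneg mult.assoc[symmetric])
    then have "(\<integral>\<^sup>+ s. ennreal (norm (of_real (K (t - s)) * G s)) \<partial>lborel)\<^sup>2
      \<le> (\<integral>\<^sup>+ s. ennreal (sqrt (K (t - s))) ^ 2 \<partial>lborel)
        * (\<integral>\<^sup>+ s. ennreal (sqrt (K (t - s)) * norm (G s)) ^ 2 \<partial>lborel)"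
      by (simp only:) (rule Cauchy_Schwarz_nn_integral; measurable)
    then show ?thesis
      by (simp add: ennreal_power power_mult_distrib kernel_nonneg ennreal_mult nn_integral_kernel)
  qed
  then have "(\<integral>\<^sup>+ t. (\<integral>\<^sup>+ s. ennreal (norm (of_real (K (t - s)) * G s)) \<partial>lborel)\<^sup>2 \<partial>lborel)
    \<le> (\<integral>\<^sup>+ t. ennreal (\<integral>s. K s \<partial>lborel)
          * (\<integral>\<^sup>+ s. ennreal (K (t - s)) * ennreal ((norm (G s))\<^sup>2) \<partial>lborel) \<partial>lborel)"
    by (intro nn_integral_mono) auto
  also have "\<dots> = ennreal ((\<integral>s. K s \<partial>lborel)\<^sup>2) * energy G"
    by (subst nn_integral_cmult, measurable, subst nn_integral_convolve)
      (auto simp: energy_def power2_eq_square ennreal_mult kernel_nonneg Bochner_Integration.integral_nonneg mult.assoc)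
  finally show ?thesis .
qed

text \<open>A finite integral of the squares in Young's inequality forces the inner integral to be
  finite almost everywhere.\<close>

lemma AE_integrable_convolve:
  assumes [measurable]: "G \<in> borel_measurable borel" and "energy G < \<infinity>"
  shows "AE t in lborel. integrable lborel (\<lambda>s. of_real (K (t - s)) * G s)"
proof -
  have "(\<integral>\<^sup>+ t. (\<integral>\<^sup>+ s. ennreal (norm (of_real (K (t - s)) * G s)) \<partial>lborel)\<^sup>2 \<partial>lborel) < \<infinity>"
    by (rule order.strict_trans1[OF nn_integral_convolve_power2])
      (use assms(2) in \<open>auto simp: ennreal_mult_less_top\<close>)
  then have "AE t in lborel. (\<integral>\<^sup>+ s. ennreal (norm (of_real (K (t - s)) * G s)) \<partial>lborel)\<^sup>2 \<noteq> \<infinity>"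
    by (intro nn_integral_PInf_AE) auto
  then show ?thesis
    by eventually_elim
      (auto simp: integrable_iff_bounded power2_eq_square less_top[symmetric])
qed

lemma energy_convolve_le:
  assumes [measurable]: "G \<in> borel_measurable borel"
  shows "energy (convolve K G) \<le> ennreal ((\<integral>s. K s \<partial>lborel)\<^sup>2) * energy G"
proof -
  have "ennreal ((norm (convolve K G t))\<^sup>2)
      \<le> (\<integral>\<^sup>+ s. ennreal (norm (of_real (K (t - s)) * G s)) \<partial>lborel)\<^sup>2" for t
  proof -
    have "ennreal (norm (convolve K G t)) \<le> (\<integral>\<^sup>+ s. ennreal (norm (of_real (K (t - s)) * G s)) \<partial>lborel)"
    \<comment> \<open>Where the integrand is not integrable, the Bochner integral is 0 by convention
      and the bound is trivial.\<close>
    proof (cases "integrable lborel (\<lambda>s. of_real (K (t - s)) * G s)")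
      case True
      then show ?thesis
        unfolding convolve_def by (rule integral_norm_bound_ennreal)
    qed (simp add: convolve_def not_integrable_integral_eq)
    then show ?thesis
      by (metis ennreal_power norm_ge_zero power_mono zero_le)
  qed
  then show ?thesis
    unfolding energy_def
    by (intro order_trans[OF nn_integral_mono nn_integral_convolve_power2[unfolded energy_def]]) auto
qed

lemma integrable_convolve:
  assumes "integrable lborel G"
  shows "integrable lborel (convolve K G)"
proof (rule integrableI_bounded)
  have [measurable]: "G \<in> borel_measurable borel" using assms by auto
  show "convolve K G \<in> borel_measurable lborel" by simp
  have "ennreal (norm (convolve K G t)) \<le> (\<integral>\<^sup>+ s. ennreal (norm (of_real (K (t - s)) * G s)) \<partial>lborel)" for t
    by (cases "integrable lborel (\<lambda>s. of_real (K (t - s)) * G s)")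
      (auto simp: convolve_def not_integrable_integral_eq intro: integral_norm_bound_ennreal)
  then have "(\<integral>\<^sup>+ t. ennreal (norm (convolve K G t)) \<partial>lborel)
      \<le> (\<integral>\<^sup>+ t. \<integral>\<^sup>+ s. ennreal (K (t - s)) * ennreal (norm (G s)) \<partial>lborel \<partial>lborel)"
    by (intro nn_integral_mono) (simp add: norm_mult kernel_nonneg ennreal_mult)
  also have "\<dots> < \<infinity>"
    using assms by (subst nn_integral_convolve) (auto simp: integrable_iff_bounded ennreal_mult_less_top)
  finally show "(\<integral>\<^sup>+ t. ennreal (norm (convolve K G t)) \<partial>lborel) < \<infinity>" .
qed

end

section \<open>The Fourier transform as an absolutely convergent integral\<close>

definition FT :: "(real \<Rightarrow> complex) \<Rightarrow> real \<Rightarrow> complex" where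
  "FT G x = of_real (1 / sqrt (2 * pi)) * (\<integral>t. iexp (- (x * t)) * G t \<partial>lborel)"

lemma borel_measurable_FT [measurable]:
  assumes [measurable]: "G \<in> borel_measurable borel"
  shows "FT G \<in> borel_measurable borel"
  unfolding FT_def by measurable

lemma integrable_iexp_mult:
  assumes "integrable lborel G"
  shows "integrable lborel (\<lambda>t. iexp (a * t) * G t)"
proof (rule Bochner_Integration.integrable_bound[OF integrable_norm[OF assms]])
  have [measurable]: "G \<in> borel_measurable borel" using assms by auto
  show "(\<lambda>t. iexp (a * t) * G t) \<in> borel_measurable lborel" by measurable
qed (auto simp: norm_mult simp del: of_real_mult)

lemma FT_diff:
  assumes "integrable lborel f" "integrable lborel g"
  shows "FT (\<lambda>t. f t - g t) x = FT f x - FT g x"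
proof -
  have "integrable lborel (\<lambda>t. iexp (- (x * t)) * f t)" "integrable lborel (\<lambda>t. iexp (- (x * t)) * g t)"
    using integrable_iexp_mult[of _ "-x"] assms by auto
  then show ?thesis
    by (simp add: FT_def right_diff_distrib)
qed

lemma norm_FT_le:
  assumes "integrable lborel G"
  shows "norm (FT G x) \<le> (\<integral>t. norm (G t) \<partial>lborel)"
proof -
  have "norm (\<integral>t. iexp (- (x * t)) * G t \<partial>lborel) \<le> (\<integral>t. norm (iexp (- (x * t)) * G t) \<partial>lborel)"
    by (rule integral_norm_bound)
  also have "\<dots> = (\<integral>t. norm (G t) \<partial>lborel)"
    by (simp add: norm_mult del: of_real_mult of_real_minus)
  finally have *: "norm (\<integral>t. iexp (- (x * t)) * G t \<partial>lborel) \<le> (\<integral>t. norm (G t) \<partial>lborel)" .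
  \<comment> \<open>The normalising factor is at most one and is discarded, as the estimate serves
    as a uniform bound.\<close>
  have "1 \<le> sqrt (2 * pi)" using pi_gt3 by simp
  then have "1 / sqrt (2 * pi) \<le> 1" by simp
  then have "1 / sqrt (2 * pi) * norm (\<integral>t. iexp (- (x * t)) * G t \<partial>lborel)
      \<le> 1 * (\<integral>t. norm (G t) \<partial>lborel)"
    by (intro mult_mono * ) auto
  then show ?thesis
    by (simp add: FT_def norm_mult norm_divide)
qed

lemma FT_reflect: "FT (\<lambda>t. G (- t)) x = FT G (- x)"
  unfolding FT_def
  by (subst (2) lborel_integral_real_affine[where c="-1" and t=0]) auto

lemma FT_modulate: "FT (\<lambda>t. iexp (a * t) * G t) x = FT G (x - a)"
proof -
  have "iexp (- (x * t)) * (iexp (a * t) * G t) = iexp (- ((x - a) * t)) * G t" for t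
    by (simp add: algebra_simps flip: exp_add)
  then show ?thesis by (simp only: FT_def)
qed

lemma FT_cnj: "FT (\<lambda>t. cnj (G t)) x = cnj (FT G (- x))"
proof -
  have "(\<integral>t. iexp (- (x * t)) * cnj (G t) \<partial>lborel) = (\<integral>t. cnj (iexp (- (- x * t)) * G t) \<partial>lborel)"
    by (intro Bochner_Integration.integral_cong refl) (simp add: exp_cnj)
  also have "\<dots> = cnj (\<integral>t. iexp (- (- x * t)) * G t \<partial>lborel)"
    by (rule Bochner_Integration.integral_cnj)
  finally show ?thesis by (simp add: FT_def)
qed

text \<open>The exponential kernel is symmetric in x and t, so both sides are the same double
  integral in the two orders.\<close>

lemma integral_FT_mult:
  assumes f: "integrable lborel f" and g: "integrable lborel g"
  shows "(\<integral>x. FT f x * g x \<partial>lborel) = (\<integral>x. f x * FT g x \<partial>lborel)"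
proof -
  have [measurable]: "f \<in> borel_measurable borel" "g \<in> borel_measurable borel"
    using f g by auto
  have "(\<integral>x. (\<integral>t. iexp (- (x * t)) * f t * g x \<partial>lborel) \<partial>lborel)
      = (\<integral>t. (\<integral>x. iexp (- (x * t)) * f t * g x \<partial>lborel) \<partial>lborel)"
  proof (rule lborel_Fubini)
    show "(\<integral>\<^sup>+ x. \<integral>\<^sup>+ t. ennreal (norm (iexp (- (x * t)) * f t * g x)) \<partial>lborel \<partial>lborel) < \<infinity>"
      using f g by (simp add: norm_mult ennreal_mult nn_integral_multc nn_integral_cmult
          ennreal_mult_less_top integrable_iff_bounded del: of_real_mult of_real_minus)
  qed measurable
  then show ?thesis
    by (simp add: FT_def mult_ac integrable_iexp_mult[of _ "-_"] f g
        flip: integral_mult_right_zero integral_mult_left_zero)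
qed

text \<open>The transform of the kernel is taken without the factor 1 / sqrt (2 pi), so that the
  product carries no power of 2 pi.\<close>

lemma (in convolution_kernel) FT_convolve:
  assumes G: "integrable lborel G"
  shows "FT (convolve K G) x = (\<integral>t. iexp (- (x * t)) * of_real (K t) \<partial>lborel) * FT G x"
proof -
  have [measurable]: "G \<in> borel_measurable borel" using G by auto
  have "(\<integral>t. (\<integral>s. iexp (- (x * t)) * (of_real (K (t - s)) * G s) \<partial>lborel) \<partial>lborel)
      = (\<integral>s. (\<integral>t. iexp (- (x * t)) * (of_real (K (t - s)) * G s) \<partial>lborel) \<partial>lborel)"
  proof (rule lborel_Fubini)
    have "(\<integral>\<^sup>+ t. \<integral>\<^sup>+ s. ennreal (norm (iexp (- (x * t)) * (of_real (K (t - s)) * G s))) \<partial>lborel \<partial>lborel)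
      = (\<integral>\<^sup>+ t. \<integral>\<^sup>+ s. ennreal (K (t - s)) * ennreal (norm (G s)) \<partial>lborel \<partial>lborel)"
      by (simp add: norm_mult ennreal_mult kernel_nonneg del: of_real_mult of_real_minus)
    also have "\<dots> < \<infinity>"
      using G by (subst nn_integral_convolve) (auto simp: integrable_iff_bounded ennreal_mult_less_top)
    finally show "(\<integral>\<^sup>+ t. \<integral>\<^sup>+ s. ennreal (norm (iexp (- (x * t)) * (of_real (K (t - s)) * G s))) \<partial>lborel \<partial>lborel) < \<infinity>" .
  qed measurable
  also have "\<dots> = (\<integral>s. (\<integral>t. iexp (- (x * t)) * of_real (K t) \<partial>lborel) * (iexp (- (x * s)) * G s) \<partial>lborel)"
  proof (intro Bochner_Integration.integral_cong refl)
    fix s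
    have "(\<integral>t. iexp (- (x * t)) * (of_real (K (t - s)) * G s) \<partial>lborel)
        = (\<integral>t. iexp (- (x * (s + 1 * t))) * (of_real (K (s + 1 * t - s)) * G s) \<partial>lborel)"
      by (subst lborel_integral_real_affine[where c=1 and t=s]) auto
    also have "\<dots> = (\<integral>t. iexp (- (x * t)) * of_real (K t) * (iexp (- (x * s)) * G s) \<partial>lborel)"
      by (intro Bochner_Integration.integral_cong refl) (simp add: algebra_simps flip: exp_add)
    finally show "(\<integral>t. iexp (- (x * t)) * (of_real (K (t - s)) * G s) \<partial>lborel)
        = (\<integral>t. iexp (- (x * t)) * of_real (K t) \<partial>lborel) * (iexp (- (x * s)) * G s)"
      by simp
  qed
  finally show ?thesis
    by (simp add: FT_def convolve_def)
qed

section \<open>Gaussian regularisation\<close>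

text \<open>After the substitution t = s z this is the characteristic function of the standard
  normal law at - s x.\<close>

lemma integral_iexp_normal_density:
  assumes s: "s > 0"
  shows "(\<integral>t. iexp (- (x * t)) * of_real (normal_density 0 s t) \<partial>lborel) = of_real (exp (- (s * x)\<^sup>2 / 2))"
proof -
  have "of_real (exp (- (s * x)\<^sup>2 / 2)) = char std_normal_distribution (- (s * x))"
    by (simp add: char_std_normal_distribution)
  also have "\<dots> = (\<integral>z. std_normal_density z *\<^sub>R iexp (- (s * x) * z) \<partial>lborel)"
    unfolding char_def by (subst integral_density) auto
  also have "\<dots> = \<bar>s\<bar> *\<^sub>R (\<integral>z. iexp (- (x * (0 + s * z))) * of_real (normal_density 0 s (0 + s * z)) \<partial>lborel)"
    unfolding integral_scaleR_right[symmetric]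
    using s by (intro Bochner_Integration.integral_cong refl)
      (simp add: normal_density_def scaleR_conv_of_real real_sqrt_mult power_mult_distrib mult_ac)
  also have "\<dots> = (\<integral>t. iexp (- (x * t)) * of_real (normal_density 0 s t) \<partial>lborel)"
    using s by (intro lborel_integral_real_affine[symmetric]) auto
  finally show ?thesis ..
qed

text \<open>Normalised to the value 1 at 0 instead of mass 1, with s an inverse width: as s tends to
  0 it tends to 1 pointwise, while its transform, sqrt (2 pi) times the normal density of deviation
  s, concentrates at 0.\<close>

abbreviation gauss :: "real \<Rightarrow> real \<Rightarrow> real" where
  "gauss s x \<equiv> exp (- (s * x)\<^sup>2 / 2)"

lemma gauss_eq_normal_density:
  "s > 0 \<Longrightarrow> gauss s x = sqrt (2 * pi) / s * normal_density 0 (1 / s) x"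
  by (simp add: normal_density_def real_sqrt_mult real_sqrt_divide power_mult_distrib field_simps)

lemma integrable_gauss:
  assumes "s > 0"
  shows "integrable lborel (gauss s)"
proof -
  have "gauss s = (\<lambda>x. sqrt (2 * pi) / s * normal_density 0 (1 / s) x)"
    by (rule ext) (rule gauss_eq_normal_density[OF assms])
  with assms show ?thesis by simp
qed

lemma FT_gauss:
  assumes s: "s > 0"
  shows "FT (\<lambda>x. of_real (gauss s x)) t = of_real (sqrt (2 * pi) * normal_density 0 s t)"
proof -
  have "(\<integral>x. iexp (- (t * x)) * of_real (gauss s x) \<partial>lborel)
      = (\<integral>x. of_real (sqrt (2 * pi) / s) * (iexp (- (t * x)) * of_real (normal_density 0 (1 / s) x)) \<partial>lborel)"
    by (intro Bochner_Integration.integral_cong refl) (subst gauss_eq_normal_density[OF s], simp)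
  also have "\<dots> = of_real (sqrt (2 * pi) / s) * of_real (gauss (1 / s) t)"
    using integral_iexp_normal_density[of "1 / s" t] s by simp
  finally have "FT (\<lambda>x. of_real (gauss s x)) t = of_real (1 / s * gauss (1 / s) t)"
    by (simp add: FT_def)
  also have "1 / s * gauss (1 / s) t = sqrt (2 * pi) * normal_density 0 s t"
    using s by (simp add: normal_density_def real_sqrt_mult power_divide)
  finally show ?thesis .
qed

lemma convolution_kernel_normal: "s > 0 \<Longrightarrow> convolution_kernel (normal_density 0 s)"
  by unfold_locales auto

text \<open>The multiplication formula with a modulated Gaussian, whose transform is a translated
  density. Evaluation at - t makes the outer transform an inverse one: damping the transform and
  inverting it amounts to smoothing G.\<close>

lemma FT_gauss_FT:
  assumes G: "integrable lborel G" and s: "s > 0"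
  shows "FT (\<lambda>x. of_real (gauss s x) * FT G x) (- t) = convolve (normal_density 0 s) G t"
proof -
  define b where "b x = iexp (t * x) * of_real (gauss s x)" for x
  have b: "integrable lborel b"
    unfolding b_def by (intro integrable_iexp_mult integrable_of_real integrable_gauss s)
  have Fb: "FT b x = of_real (sqrt (2 * pi) * normal_density 0 s (t - x))" for x
    unfolding b_def FT_modulate FT_gauss[OF s] by (simp add: normal_density_def power2_commute)
  have "FT (\<lambda>x. of_real (gauss s x) * FT G x) (- t) = of_real (1 / sqrt (2 * pi)) * (\<integral>x. FT G x * b x \<partial>lborel)"
    by (simp add: FT_def b_def mult_ac)
  also have "\<dots> = of_real (1 / sqrt (2 * pi)) * (\<integral>x. G x * FT b x \<partial>lborel)"
    by (simp only: integral_FT_mult[OF G b])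
  also have "\<dots> = convolve (normal_density 0 s) G t"
    by (simp add: convolve_def Fb mult_ac flip: integral_mult_right_zero)
  finally show ?thesis .
qed

lemma borel_measurable_cnj [measurable]: "cnj \<in> borel_measurable borel"
  by (intro borel_measurable_continuous_onI continuous_intros)

lemma integrable_gauss_mult:
  fixes h :: "real \<Rightarrow> complex"
  assumes [measurable]: "h \<in> borel_measurable borel" and h: "\<And>x. norm (h x) \<le> B" and s: "s > 0"
  shows "integrable lborel (\<lambda>x. of_real (gauss s x) * h x)"
proof (rule Bochner_Integration.integrable_bound)
  show "integrable lborel (\<lambda>x. B * gauss s x)"
    using integrable_gauss[OF s] by simp
  have "0 \<le> B" using h[of 0] norm_ge_zero order_trans by blast
  then show "AE x in lborel. norm (of_real (gauss s x) * h x) \<le> norm (B * gauss s x)"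
    using h by (auto simp: norm_mult mult.commute intro!: mult_right_mono)
qed measurable

lemma gauss_energy_FT_le:
  assumes G: "integrable lborel G" and fin: "energy G < \<infinity>" and s: "s > 0"
  shows "(\<integral>\<^sup>+ x. ennreal (gauss s x * (norm (FT G x))\<^sup>2) \<partial>lborel) \<le> energy G"
proof -
  interpret convolution_kernel "normal_density 0 s" by (rule convolution_kernel_normal[OF s])
  let ?C = "convolve (normal_density 0 s) G"
  have [measurable]: "G \<in> borel_measurable borel" using G by auto
  have gF: "integrable lborel (\<lambda>x. of_real (gauss s x) * FT G x)"
    by (intro integrable_gauss_mult[OF _ norm_FT_le[OF G] s]) measurable
  have gF': "integrable lborel (\<lambda>x. cnj (of_real (gauss s x) * FT G x))"
    using gF by (rule integrable_cnj)
  have "integrable lborel (\<lambda>x. of_real (gauss s x) * (cnj (FT G x) * FT G x))"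
  proof (rule integrable_gauss_mult[OF _ _ s])
    show "norm (cnj (FT G x) * FT G x) \<le> (\<integral>t. norm (G t) \<partial>lborel) * (\<integral>t. norm (G t) \<partial>lborel)" for x
      unfolding norm_mult complex_mod_cnj
      by (intro mult_mono norm_FT_le G) auto
  qed measurable
  then have int: "integrable lborel (\<lambda>x. FT G x * cnj (of_real (gauss s x) * FT G x))"
    by (simp add: mult_ac)
  have eq: "FT G x * cnj (of_real (gauss s x) * FT G x) = of_real (gauss s x * (norm (FT G x))\<^sup>2)" for x
    by (simp add: complex_norm_square mult_ac del: of_real_exp of_real_power)
  have int': "integrable lborel (\<lambda>x. gauss s x * (norm (FT G x))\<^sup>2)"
    using int unfolding eq by (simp add: complex_of_real_integrable_eq del: of_real_mult)
  have "FT (\<lambda>x. cnj (of_real (gauss s x) * FT G x)) t = cnj (?C t)" for t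
    by (simp only: FT_cnj FT_gauss_FT[OF G s])
  then have "(\<integral>x. FT G x * cnj (of_real (gauss s x) * FT G x) \<partial>lborel) = (\<integral>t. G t * cnj (?C t) \<partial>lborel)"
    using integral_FT_mult[OF G gF'] by simp
  then have I: "of_real (\<integral>x. gauss s x * (norm (FT G x))\<^sup>2 \<partial>lborel) = (\<integral>t. G t * cnj (?C t) \<partial>lborel)"
    unfolding eq by (simp only: integral_complex_of_real)
  have bound: "(\<integral>\<^sup>+ t. ennreal (norm (G t * cnj (?C t))) \<partial>lborel) \<le> energy G"
  proof -
    \<comment> \<open>The inequality 2ab \<le> a^2 + b^2 takes the place of Cauchy-Schwarz; it gives
      the sharp constant because the smoothed function has no more energy than G.\<close>
    have "2 * ennreal (norm (G t * cnj (?C t))) \<le> ennreal ((norm (G t))\<^sup>2) + ennreal ((norm (?C t))\<^sup>2)" for t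
    proof -
      have "2 * norm (G t * cnj (?C t)) \<le> (norm (G t))\<^sup>2 + (norm (?C t))\<^sup>2"
        using zero_le_power2[of "norm (G t) - norm (?C t)"] unfolding power2_diff by (simp add: norm_mult)
      from ennreal_leI[OF this] show ?thesis by (simp add: ennreal_mult)
    qed
    then have "(\<integral>\<^sup>+ t. 2 * ennreal (norm (G t * cnj (?C t))) \<partial>lborel)
        \<le> (\<integral>\<^sup>+ t. ennreal ((norm (G t))\<^sup>2) + ennreal ((norm (?C t))\<^sup>2) \<partial>lborel)"
      by (intro nn_integral_mono)
    also have "\<dots> = energy G + energy ?C"
      unfolding energy_def by (subst nn_integral_add) auto
    \<comment> \<open>Young's inequality with a kernel of integral one.\<close>
    also have "\<dots> \<le> energy G + energy G"
      using energy_convolve_le[of G] s by (intro add_left_mono) simp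
    also have "\<dots> = 2 * energy G" by (simp add: mult_2)
    finally have "2 * (\<integral>\<^sup>+ t. ennreal (norm (G t * cnj (?C t))) \<partial>lborel) \<le> 2 * energy G"
      by (subst (asm) nn_integral_cmult) auto
    then show ?thesis by (simp add: ennreal_mult_le_mult_iff)
  qed
  then have "integrable lborel (\<lambda>t. G t * cnj (?C t))"
    using fin by (auto simp: integrable_iff_bounded)
  from integral_norm_bound_ennreal[OF this]
  have "ennreal (norm (complex_of_real (\<integral>x. gauss s x * (norm (FT G x))\<^sup>2 \<partial>lborel))) \<le> energy G"
    unfolding I using bound by simp
  then show ?thesis
    by (subst nn_integral_eq_integral[OF int'])
      (auto simp: Bochner_Integration.integral_nonneg simp del: integral_complex_of_real)
qed

lemma gauss_tendsto_1: "(\<lambda>n. gauss (1 / Suc n) x) \<longlonglongrightarrow> 1"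
proof -
  have "(\<lambda>n. gauss (1 / Suc n) x) \<longlonglongrightarrow> exp (- (0 * x)\<^sup>2 / 2)"
    by (intro tendsto_intros LIMSEQ_Suc[OF lim_1_over_n]) simp
  then show ?thesis by simp
qed

lemma energy_FT_le:
  assumes G: "integrable lborel G" and fin: "energy G < \<infinity>"
  shows "energy (FT G) \<le> energy G"
proof -
  have [measurable]: "G \<in> borel_measurable borel" using G by auto
  have "energy (FT G)
      = (\<integral>\<^sup>+ x. liminf (\<lambda>n. ennreal (gauss (1 / Suc n) x * (norm (FT G x))\<^sup>2)) \<partial>lborel)"
    unfolding energy_def
  proof (rule nn_integral_cong)
    fix x
    have "(\<lambda>n. ennreal (gauss (1 / Suc n) x * (norm (FT G x))\<^sup>2)) \<longlonglongrightarrow> ennreal (1 * (norm (FT G x))\<^sup>2)"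
      by (intro tendsto_intros tendsto_ennrealI gauss_tendsto_1)
    then show "ennreal ((norm (FT G x))\<^sup>2) = liminf (\<lambda>n. ennreal (gauss (1 / Suc n) x * (norm (FT G x))\<^sup>2))"
      using lim_imp_Liminf[OF trivial_limit_sequentially] by fastforce
  qed
  also have "\<dots> \<le> liminf (\<lambda>n. \<integral>\<^sup>+ x. ennreal (gauss (1 / Suc n) x * (norm (FT G x))\<^sup>2) \<partial>lborel)"
    by (rule nn_integral_liminf) measurable
  also have "\<dots> \<le> limsup (\<lambda>n. \<integral>\<^sup>+ x. ennreal (gauss (1 / Suc n) x * (norm (FT G x))\<^sup>2) \<partial>lborel)"
    by (intro Liminf_le_Limsup) auto
  also have "\<dots> \<le> energy G"
    by (intro Limsup_bounded always_eventually allI gauss_energy_FT_le assms) auto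
  finally show ?thesis .
qed

section \<open>The Fourier transform on square integrable functions\<close>

definition truncate :: "real \<Rightarrow> (real \<Rightarrow> complex) \<Rightarrow> real \<Rightarrow> complex" where
  "truncate R G t = indicator {-R..R} t *\<^sub>R G t"

lemma borel_measurable_truncate [measurable]:
  assumes [measurable]: "G \<in> borel_measurable borel"
  shows "truncate R G \<in> borel_measurable borel"
  unfolding truncate_def by measurable

lemma norm_truncate_le: "norm (truncate R G t) \<le> norm (G t)"
  by (simp add: truncate_def split: split_indicator)

lemma energy_truncate_le: "energy (truncate R G) \<le> energy G"
  by (intro energy_mono norm_truncate_le)

definition L12 :: "(real \<Rightarrow> complex) \<Rightarrow> bool" where
  "L12 G \<longleftrightarrow> integrable lborel G \<and> energy G < \<infinity>"

lemma L12_measurable: "L12 G \<Longrightarrow> G \<in> borel_measurable borel"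
  by (auto simp: L12_def)

lemma L12_truncate:
  assumes [measurable]: "G \<in> borel_measurable borel" and fin: "energy G < \<infinity>"
  shows "L12 (truncate R G)"
proof -
  have int: "integrable lborel (\<lambda>t. indicator {-R..R} t + (norm (G t))\<^sup>2)"
    using energy_finite_iff[of G] fin
    by (intro Bochner_Integration.integrable_add) (auto simp: integrable_indicator_iff emeasure_lborel_Icc_eq)
  \<comment> \<open>A bounded interval has finite measure and |z| \<le> 1 + |z|^2, so square
    integrability gives integrability there.\<close>
  have "norm (truncate R G t) \<le> indicator {-R..R} t + (norm (G t))\<^sup>2" for t
    using zero_le_power2[of "norm (G t) - 1/2"] unfolding power2_diff
    by (simp add: truncate_def power2_eq_square split: split_indicator)
  then have "integrable lborel (truncate R G)"
    by (intro Bochner_Integration.integrable_bound[OF int]) auto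
  then show ?thesis
    using energy_truncate_le[of R G] fin by (auto simp: L12_def)
qed

text \<open>Dominated convergence speaks of sequences, so the limit in the real parameter R is
  tested along arbitrary sequences tending to infinity.\<close>

lemma tendsto_energy_truncate:
  assumes [measurable]: "G \<in> borel_measurable borel" and fin: "energy G < \<infinity>"
  shows "((\<lambda>R. energy (\<lambda>t. truncate R G t - G t)) \<longlongrightarrow> 0) at_top"
proof (rule tendsto_at_topI_sequentially)
  fix X :: "nat \<Rightarrow> real" assume X: "filterlim X at_top sequentially"
  show "(\<lambda>n. energy (\<lambda>t. truncate (X n) G t - G t)) \<longlonglongrightarrow> 0"
  proof (rule energy_dominated_convergence[where d=G])
    have "(\<lambda>n. truncate (X n) G t) \<longlonglongrightarrow> G t" for t
    proof (rule tendsto_eventually)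
      have "\<forall>\<^sub>F n in sequentially. \<bar>t\<bar> \<le> X n"
        using X by (simp add: filterlim_at_top)
      then show "\<forall>\<^sub>F n in sequentially. truncate (X n) G t = G t"
        by eventually_elim (auto simp: truncate_def indicator_def)
    qed
    then show "AE t in lborel. (\<lambda>n. truncate (X n) G t) \<longlonglongrightarrow> G t" by simp
  qed (use fin norm_truncate_le in auto)
qed

text \<open>The scalar, unweighted form of \<open>is_FL\<close>. It is a relation because H is
  determined only up to null sets; measurability and finite energy of G are part of it.\<close>

definition L2_FT :: "(real \<Rightarrow> complex) \<Rightarrow> (real \<Rightarrow> complex) \<Rightarrow> bool" where
  "L2_FT G H \<longleftrightarrow> G \<in> borel_measurable borel \<and> energy G < \<infinity> \<and> H \<in> borel_measurable borel \<and>
     ((\<lambda>R. energy (\<lambda>x. FT (truncate R G) x - H x)) \<longlongrightarrow> 0) at_top"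

lemma L2_FT_measurable:
  "L2_FT G H \<Longrightarrow> G \<in> borel_measurable borel" "L2_FT G H \<Longrightarrow> H \<in> borel_measurable borel"
  by (auto simp: L2_FT_def)

lemma energy_FT_diff_le:
  assumes "L12 f" "L12 g"
  shows "energy (\<lambda>x. FT f x - FT g x) \<le> energy (\<lambda>x. f x - g x)"
proof -
  have [measurable]: "f \<in> borel_measurable borel" "g \<in> borel_measurable borel"
    using assms L12_measurable by auto
  have "energy (\<lambda>x. f x - g x) \<le> 2 * energy f + 2 * energy g"
    using energy_add_le[of f "\<lambda>x. - g x"] by simp
  also have "\<dots> < \<infinity>" using assms by (auto simp: L12_def ennreal_mult_less_top)
  finally have "energy (FT (\<lambda>x. f x - g x)) \<le> energy (\<lambda>x. f x - g x)"
    using assms by (intro energy_FT_le) (auto simp: L12_def)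
  moreover have "FT (\<lambda>x. f x - g x) = (\<lambda>x. FT f x - FT g x)"
    using assms by (intro ext FT_diff) (auto simp: L12_def)
  ultimately show ?thesis by simp
qed

text \<open>The common source of the limit arguments that follow: f and g are two approximants of G
  in L^1 and L^2, and the error of the transform of f is controlled by that of g. The factor 4 comes
  from using the quasi-triangle inequality twice.\<close>

lemma energy_FT_compare:
  assumes "L12 f" "L12 g" and [measurable]: "G \<in> borel_measurable borel" "H \<in> borel_measurable borel"
  shows "energy (\<lambda>x. FT f x - H x) \<le> 4 * energy (\<lambda>x. f x - G x) + 4 * energy (\<lambda>x. g x - G x)
      + 2 * energy (\<lambda>x. FT g x - H x)"
proof -
  have [measurable]: "f \<in> borel_measurable borel" "g \<in> borel_measurable borel"
    using assms L12_measurable by auto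
  have "energy (\<lambda>x. FT f x - H x)
      \<le> 2 * energy (\<lambda>x. FT f x - FT g x) + 2 * energy (\<lambda>x. FT g x - H x)"
    by (rule energy_triangle) auto
  also have "\<dots> \<le> 2 * energy (\<lambda>x. f x - g x) + 2 * energy (\<lambda>x. FT g x - H x)"
    by (intro add_right_mono mult_left_mono energy_FT_diff_le assms) auto
  also have "\<dots> \<le> 2 * (2 * energy (\<lambda>x. f x - G x) + 2 * energy (\<lambda>x. G x - g x))
      + 2 * energy (\<lambda>x. FT g x - H x)"
    by (intro add_right_mono mult_left_mono energy_triangle) auto
  also have "\<dots> = 4 * energy (\<lambda>x. f x - G x) + 4 * energy (\<lambda>x. g x - G x)
      + 2 * energy (\<lambda>x. FT g x - H x)"
    by (simp add: distrib_left energy_diff_commute[of G] flip: mult.assoc)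
  finally show ?thesis .
qed

text \<open>The truncations may be replaced by any approximating sequence: letting n tend to
  infinity in \<open>energy_FT_compare\<close> leaves four times the truncation error of G, which
  vanishes as R grows.\<close>

lemma L2_FT_limitI:
  assumes f: "\<And>n. L12 (f n)" and [measurable]: "G \<in> borel_measurable borel"
      "H \<in> borel_measurable borel"
    and fin: "energy G < \<infinity>"
    and fG: "(\<lambda>n. energy (\<lambda>x. f n x - G x)) \<longlonglongrightarrow> 0"
    and fH: "(\<lambda>n. energy (\<lambda>x. FT (f n) x - H x)) \<longlonglongrightarrow> 0"
  shows "L2_FT G H"
proof -
  have le: "energy (\<lambda>x. FT (truncate R G) x - H x) \<le> 4 * energy (\<lambda>x. truncate R G x - G x)" for R
  proof (rule LIMSEQ_le_const)
    show "(\<lambda>n. 4 * energy (\<lambda>x. truncate R G x - G x) + 4 * energy (\<lambda>x. f n x - G x)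
      + 2 * energy (\<lambda>x. FT (f n) x - H x)) \<longlonglongrightarrow> 4 * energy (\<lambda>x. truncate R G x - G x)"
      using tendsto_add[OF tendsto_add[OF tendsto_const ennreal_tendsto_cmult[OF _ fG, of 4]]
          ennreal_tendsto_cmult[OF _ fH, of 2]] by simp
  qed (use energy_FT_compare[OF L12_truncate f] fin in auto)
  have "((\<lambda>R. energy (\<lambda>x. FT (truncate R G) x - H x)) \<longlongrightarrow> 0) at_top"
  proof (rule tendsto_sandwich[where f="\<lambda>_. 0"])
    show "((\<lambda>R. 4 * energy (\<lambda>x. truncate R G x - G x)) \<longlongrightarrow> 0) at_top"
      using ennreal_tendsto_cmult[OF _ tendsto_energy_truncate[of G], of 4] fin by simp
  qed (use le in auto)
  with fin show ?thesis by (simp add: L2_FT_def)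
qed

lemma L2_FT_compare_L12:
  assumes f: "L12 f" and GH: "L2_FT G H"
  shows "energy (\<lambda>x. FT f x - H x) \<le> 4 * energy (\<lambda>x. f x - G x)"
proof (rule tendsto_lowerbound)
  note [measurable] = L2_FT_measurable[OF GH]
  have fin: "energy G < \<infinity>" and lim: "((\<lambda>R. energy (\<lambda>x. FT (truncate R G) x - H x)) \<longlongrightarrow> 0) at_top"
    using GH by (auto simp: L2_FT_def)
  show "((\<lambda>R. 4 * energy (\<lambda>x. f x - G x) + 4 * energy (\<lambda>x. truncate R G x - G x)
      + 2 * energy (\<lambda>x. FT (truncate R G) x - H x)) \<longlongrightarrow> 4 * energy (\<lambda>x. f x - G x)) at_top"
    using tendsto_add[OF tendsto_add[OF tendsto_const
          ennreal_tendsto_cmult[OF _ tendsto_energy_truncate[of G], of 4]]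
        ennreal_tendsto_cmult[OF _ lim, of 2]] fin by simp
  show "\<forall>\<^sub>F R in at_top. energy (\<lambda>x. FT f x - H x)
      \<le> 4 * energy (\<lambda>x. f x - G x) + 4 * energy (\<lambda>x. truncate R G x - G x)
      + 2 * energy (\<lambda>x. FT (truncate R G) x - H x)"
    using energy_FT_compare[OF f L12_truncate] fin by (intro always_eventually) auto
qed simp

lemma L2_FT_limit:
  assumes f: "\<And>n. L12 (f n)" and GH: "L2_FT G H"
    and fG: "(\<lambda>n. energy (\<lambda>x. f n x - G x)) \<longlonglongrightarrow> 0"
  shows "(\<lambda>n. energy (\<lambda>x. FT (f n) x - H x)) \<longlonglongrightarrow> 0"
proof (rule tendsto_sandwich[where f="\<lambda>_. 0"])
  show "(\<lambda>n. 4 * energy (\<lambda>x. f n x - G x)) \<longlonglongrightarrow> 0"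
    using ennreal_tendsto_cmult[OF _ fG, of 4] by simp
qed (use L2_FT_compare_L12[OF f GH] in auto)

lemma L2_FT_FT: "L12 G \<Longrightarrow> L2_FT G (FT G)"
  by (rule L2_FT_limitI[where f="\<lambda>_. G"]) (auto simp: energy_def L12_def)

text \<open>The factor 2 is the price of the quasi-triangle inequality. Applied to differences, the
  bound yields continuity and uniqueness of the transform.\<close>

lemma L2_FT_energy_le:
  assumes GH: "L2_FT G H"
  shows "energy H \<le> 2 * energy G"
proof (rule tendsto_lowerbound)
  note [measurable] = L2_FT_measurable[OF GH]
  have fin: "energy G < \<infinity>" and lim: "((\<lambda>R. energy (\<lambda>x. FT (truncate R G) x - H x)) \<longlongrightarrow> 0) at_top"
    using GH by (auto simp: L2_FT_def)
  show "((\<lambda>R. 2 * energy (\<lambda>x. FT (truncate R G) x - H x) + 2 * energy G) \<longlongrightarrow> 2 * energy G) at_top"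
    using tendsto_add[OF ennreal_tendsto_cmult[OF _ lim, of 2] tendsto_const] by simp
  have "energy H \<le> 2 * energy (\<lambda>x. FT (truncate R G) x - H x) + 2 * energy G" for R
  proof -
    have "energy H \<le> 2 * energy (\<lambda>x. H x - FT (truncate R G) x) + 2 * energy (FT (truncate R G))"
      using energy_add_le[of "\<lambda>x. H x - FT (truncate R G) x" "FT (truncate R G)"] by simp
    also have "energy (FT (truncate R G)) \<le> energy (truncate R G)"
      using L12_truncate[of G R] fin by (intro energy_FT_le) (auto simp: L12_def)
    also have "energy (truncate R G) \<le> energy G" by (rule energy_truncate_le)
    finally show ?thesis by (simp add: energy_diff_commute[of H] add_left_mono mult_left_mono)
  qed
  then show "\<forall>\<^sub>F R in at_top. energy H \<le> 2 * energy (\<lambda>x. FT (truncate R G) x - H x) + 2 * energy G"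
    by (intro always_eventually) auto
qed simp

lemma L2_FT_finite: "L2_FT G H \<Longrightarrow> energy G < \<infinity>" "L2_FT G H \<Longrightarrow> energy H < \<infinity>"
  by (auto simp: L2_FT_def) (rule order.strict_trans1[OF L2_FT_energy_le],
      auto simp: L2_FT_def ennreal_mult_less_top)

lemma L2_FT_diff:
  assumes 1: "L2_FT G1 H1" and 2: "L2_FT G2 H2"
  shows "L2_FT (\<lambda>t. G1 t - G2 t) (\<lambda>x. H1 x - H2 x)"
proof -
  note [measurable] = L2_FT_measurable[OF 1] L2_FT_measurable[OF 2]
  note fin = L2_FT_finite(1)[OF 1] L2_FT_finite(1)[OF 2]
  have lin: "FT (truncate R (\<lambda>t. G1 t - G2 t)) x = FT (truncate R G1) x - FT (truncate R G2) x" for R x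
  proof -
    have "truncate R (\<lambda>t. G1 t - G2 t) = (\<lambda>t. truncate R G1 t - truncate R G2 t)"
      by (auto simp: truncate_def scaleR_diff_right)
    then show ?thesis
      using L12_truncate[of G1 R] L12_truncate[of G2 R] fin by (simp add: FT_diff L12_def)
  qed
  have "energy (\<lambda>t. G1 t - G2 t) \<le> 2 * energy G1 + 2 * energy G2"
    using energy_add_le[of G1 "\<lambda>x. - G2 x"] by simp
  also have "\<dots> < \<infinity>" using fin by (simp add: ennreal_mult_less_top)
  finally have fin': "energy (\<lambda>t. G1 t - G2 t) < \<infinity>" .
  let ?a = "\<lambda>R. energy (\<lambda>x. FT (truncate R G1) x - H1 x)"
  let ?b = "\<lambda>R. energy (\<lambda>x. FT (truncate R G2) x - H2 x)"
  have "((\<lambda>R. energy (\<lambda>x. FT (truncate R (\<lambda>t. G1 t - G2 t)) x - (H1 x - H2 x))) \<longlongrightarrow> 0) at_top"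
  proof (rule tendsto_sandwich[where f="\<lambda>_. 0"])
    show "((\<lambda>R. 2 * ?a R + 2 * ?b R) \<longlongrightarrow> 0) at_top"
      using 1 2 tendsto_add[OF ennreal_tendsto_cmult[of 2 ?a 0] ennreal_tendsto_cmult[of 2 ?b 0]]
      by (simp add: L2_FT_def)
    have "energy (\<lambda>x. FT (truncate R (\<lambda>t. G1 t - G2 t)) x - (H1 x - H2 x)) \<le> 2 * ?a R + 2 * ?b R" for R
      using energy_add_le[of "\<lambda>x. FT (truncate R G1) x - H1 x" "\<lambda>x. - (FT (truncate R G2) x - H2 x)"]
      unfolding energy_uminus lin by (simp add: algebra_simps)
    then show "\<forall>\<^sub>F R in at_top. energy (\<lambda>x. FT (truncate R (\<lambda>t. G1 t - G2 t)) x - (H1 x - H2 x))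
        \<le> 2 * ?a R + 2 * ?b R"
      by (intro always_eventually) auto
  qed auto
  with fin' show ?thesis by (simp add: L2_FT_def)
qed

lemma L2_FT_cong_AE:
  assumes GH: "L2_FT G H" and [measurable]: "G' \<in> borel_measurable borel" "H' \<in> borel_measurable borel"
    and G: "AE t in lborel. G t = G' t" and H: "AE x in lborel. H x = H' x"
  shows "L2_FT G' H'"
proof -
  note [measurable] = L2_FT_measurable[OF GH]
  have "FT (truncate R G') = FT (truncate R G)" for R
    unfolding FT_def using G
    by (intro ext arg_cong2[where f=times] refl integral_cong_AE) (auto simp: truncate_def)
  moreover have "energy (\<lambda>x. FT (truncate R G) x - H' x) = energy (\<lambda>x. FT (truncate R G) x - H x)" for R
    using H by (intro energy_cong_AE) auto
  moreover have "energy G' = energy G"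
    using G by (intro energy_cong_AE) auto
  ultimately show ?thesis using GH by (simp add: L2_FT_def)
qed

lemma L2_FT_unique:
  assumes 1: "L2_FT G H1" and 2: "L2_FT G H2"
  shows "AE x in lborel. H1 x = H2 x"
proof -
  note [measurable] = L2_FT_measurable[OF 1] L2_FT_measurable[OF 2]
  have "energy (\<lambda>x. H1 x - H2 x) \<le> 2 * energy (\<lambda>x. G x - G x)"
    by (rule L2_FT_energy_le[OF L2_FT_diff[OF 1 2]])
  then have "energy (\<lambda>x. H1 x - H2 x) = 0" by (simp add: energy_def)
  then show ?thesis by (subst (asm) energy_eq_0_iff) auto
qed

lemma L2_FT_reflect:
  assumes GH: "L2_FT G H"
  shows "L2_FT (\<lambda>t. G (- t)) (\<lambda>x. H (- x))"
proof -
  note [measurable] = L2_FT_measurable[OF GH]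
  have "truncate R (\<lambda>t. G (- t)) = (\<lambda>t. truncate R G (- t))" for R
    by (rule ext) (auto simp: truncate_def indicator_def)
  then have "FT (truncate R (\<lambda>t. G (- t))) x = FT (truncate R G) (- x)" for R x
    by (simp add: FT_reflect)
  then show ?thesis
    using GH energy_reflect[of G] energy_reflect[of "\<lambda>x. FT (truncate R G) x - H x" for R]
    by (simp add: L2_FT_def)
qed

lemma L2_FT_exists:
  assumes [measurable]: "G \<in> borel_measurable borel" and fin: "energy G < \<infinity>"
  shows "\<exists>H. L2_FT G H"
proof -
  define f where "f n = truncate (real n) G" for n
  have f: "L12 (f n)" for n
    unfolding f_def by (rule L12_truncate) (use fin in auto)
  note [measurable] = L12_measurable[OF f]
  have fG: "(\<lambda>n. energy (\<lambda>x. f n x - G x)) \<longlonglongrightarrow> 0"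
    unfolding f_def
    by (rule filterlim_compose[OF tendsto_energy_truncate filterlim_real_sequentially]) (use fin in auto)
  have "\<exists>H \<in> borel_measurable borel. (\<lambda>n. energy (\<lambda>x. FT (f n) x - H x)) \<longlonglongrightarrow> 0"
  proof (rule energy_complete)
    fix e :: real assume e: "e > 0"
    \<comment> \<open>The share e / 4 is what two errors may cost when each is doubled by the
      quasi-triangle inequality.\<close>
    then have "\<forall>\<^sub>F n in sequentially. energy (\<lambda>x. f n x - G x) < ennreal (e / 4)"
      by (intro order_tendstoD[OF fG]) auto
    then obtain N where N: "\<And>n. n \<ge> N \<Longrightarrow> energy (\<lambda>x. f n x - G x) \<le> ennreal (e / 4)"
      unfolding eventually_sequentially by (meson less_imp_le)
    have "energy (\<lambda>x. FT (f m) x - FT (f n) x) \<le> ennreal e" if "m \<ge> N" "n \<ge> N" for m n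
    proof -
      have "energy (\<lambda>x. FT (f m) x - FT (f n) x) \<le> energy (\<lambda>x. f m x - f n x)"
        by (rule energy_FT_diff_le[OF f f])
      also have "\<dots> \<le> 2 * energy (\<lambda>x. f m x - G x) + 2 * energy (\<lambda>x. G x - f n x)"
        by (rule energy_triangle) auto
      also have "\<dots> \<le> 2 * ennreal (e / 4) + 2 * ennreal (e / 4)"
        using N[OF that(1)] N[OF that(2)] by (intro add_mono mult_left_mono) (auto simp: energy_diff_commute[of G])
      also have "2 * ennreal (e / 4) = ennreal (e / 2)"
        using ennreal_mult[of 2 "e / 4"] e by simp
      also have "ennreal (e / 2) + ennreal (e / 2) = ennreal e"
        using e by (simp flip: ennreal_plus)
      finally show ?thesis .
    qed
    then show "\<exists>N. \<forall>m\<ge>N. \<forall>n\<ge>N. energy (\<lambda>x. FT (f m) x - FT (f n) x) \<le> ennreal e" by blast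
  qed measurable
  then show ?thesis using L2_FT_limitI[OF f _ _ fin fG] by auto
qed

section \<open>Inversion and convolution\<close>

text \<open>Substituting s = t - z / (n + 1) fixes the density and moves the scale into the argument
  of G; continuity gives the pointwise limit and boundedness the majorant.\<close>

lemma convolve_normal_tendsto:
  assumes G: "continuous_on UNIV G" and B: "\<And>t. norm (G t) \<le> B"
  shows "(\<lambda>n. convolve (normal_density 0 (1 / Suc n)) G t) \<longlonglongrightarrow> G t"
proof -
  have [measurable]: "G \<in> borel_measurable borel"
    using G by (rule borel_measurable_continuous_onI)
  have eq: "convolve (normal_density 0 s) G t = (\<integral>z. of_real (std_normal_density z) * G (t - s * z) \<partial>lborel)"
    if s: "s > 0" for s
  proof -
    have "convolve (normal_density 0 s) G t
        = \<bar>- s\<bar> *\<^sub>R (\<integral>z. of_real (normal_density 0 s (t - (t + - s * z))) * G (t + - s * z) \<partial>lborel)"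
      unfolding convolve_def using s by (intro lborel_integral_real_affine) auto
    also have "\<dots> = (\<integral>z. of_real (std_normal_density z) * G (t - s * z) \<partial>lborel)"
      unfolding integral_scaleR_right[symmetric]
      using s by (intro Bochner_Integration.integral_cong refl)
        (simp add: normal_density_def scaleR_conv_of_real real_sqrt_mult power_mult_distrib mult_ac)
    finally show ?thesis .
  qed
  have "(\<lambda>n. \<integral>z. of_real (std_normal_density z) * G (t - 1 / Suc n * z) \<partial>lborel)
      \<longlonglongrightarrow> (\<integral>z. of_real (std_normal_density z) * G t \<partial>lborel)"
  proof (rule integral_dominated_convergence[where w="\<lambda>z. B * std_normal_density z"])
    show "AE z in lborel. (\<lambda>n. of_real (std_normal_density z) * G (t - 1 / Suc n * z))
        \<longlonglongrightarrow> of_real (std_normal_density z) * G t"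
    proof (intro AE_I2 tendsto_mult tendsto_const)
      fix z
      have "(\<lambda>n. t - 1 / Suc n * z) \<longlonglongrightarrow> t - 0 * z"
        by (intro tendsto_intros LIMSEQ_Suc[OF lim_1_over_n])
      moreover have "isCont G t" using G by (simp add: continuous_on_eq_continuous_at)
      ultimately show "(\<lambda>n. G (t - 1 / Suc n * z)) \<longlonglongrightarrow> G t"
        by (intro isCont_tendsto_compose[of t G]) auto
    qed
    show "AE z in lborel. norm (of_real (std_normal_density z) * G (t - 1 / Suc n * z))
        \<le> B * std_normal_density z" for n
      using B by (intro AE_I2) (simp add: norm_mult mult.commute[of B] mult_left_mono)
  qed auto
  then show ?thesis by (simp add: eq)
qed

definition FT_invertible :: "(real \<Rightarrow> complex) \<Rightarrow> bool" where
  "FT_invertible G \<longleftrightarrow> (\<forall>H. L2_FT G H \<longrightarrow> L2_FT H (\<lambda>t. G (- t)))"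

lemma FT_invertible_continuous:
  assumes cont: "continuous_on UNIV G" and B: "\<And>t. norm (G t) \<le> B" and G: "L12 G"
  shows "FT_invertible G"
  unfolding FT_invertible_def
proof (intro allI impI)
  fix H assume GH: "L2_FT G H"
  note [measurable] = L2_FT_measurable[OF GH]
  have int: "integrable lborel G" and fin: "energy (FT G) < \<infinity>"
    using G energy_FT_le[of G] by (auto simp: L12_def)
  have FH: "AE x in lborel. FT G x = H x"
    by (rule L2_FT_unique[OF L2_FT_FT[OF G] GH])
  \<comment> \<open>U is the mean-square transform of \<open>FT G\<close>. Unlike
    \<open>FT G\<close>, which need not be integrable, its Gaussian-damped versions
    \<open>g n\<close> have transforms given by integrals; these tend to U in energy and to G (- t)
    pointwise.\<close>
  obtain U where U: "L2_FT (FT G) U"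
    using L2_FT_exists[of "FT G"] fin by auto
  note [measurable] = L2_FT_measurable[OF U]
  define g where "g n x = of_real (gauss (1 / Suc n) x) * FT G x" for n x
  have norm_g: "norm (g n x) \<le> norm (FT G x)" for n x
    unfolding g_def norm_mult by (intro mult_left_le_one_le) auto
  have g: "L12 (g n)" for n
    unfolding L12_def
  proof
    show "integrable lborel (g n)"
      unfolding g_def by (intro integrable_gauss_mult[OF _ norm_FT_le[OF int]]) auto
    show "energy (g n) < \<infinity>"
      using energy_mono[OF norm_g] fin by (rule order.strict_trans1)
  qed
  note [measurable] = L12_measurable[OF g]
  have "(\<lambda>n. energy (\<lambda>x. g n x - FT G x)) \<longlonglongrightarrow> 0"
  proof (rule energy_dominated_convergence[where d="FT G"])
    have "(\<lambda>n. g n x) \<longlonglongrightarrow> of_real 1 * FT G x" for x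
      unfolding g_def by (intro tendsto_mult tendsto_of_real gauss_tendsto_1 tendsto_const)
    then show "AE x in lborel. (\<lambda>n. g n x) \<longlonglongrightarrow> FT G x" by simp
  qed (use fin norm_g in auto)
  then have "(\<lambda>n. energy (\<lambda>x. FT (g n) x - U x)) \<longlonglongrightarrow> 0"
    by (rule L2_FT_limit[OF g U])
  moreover have "(\<lambda>n. FT (g n) t) \<longlonglongrightarrow> G (- t)" for t
  proof -
    have "FT (g n) t = convolve (normal_density 0 (1 / Suc n)) G (- t)" for n
      unfolding g_def using FT_gauss_FT[OF int, of "1 / Suc n" "- t"] by simp
    then show ?thesis using convolve_normal_tendsto[OF cont B] by simp
  qed
  ultimately have "AE t in lborel. G (- t) = U t"
    by (intro pointwise_limit_eq_energy_limit[where f="\<lambda>n. FT (g n)"]) auto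
  then show "L2_FT H (\<lambda>t. G (- t))"
    by (intro L2_FT_cong_AE[OF U _ _ FH]) (auto elim: eventually_mono)
qed

text \<open>The round trip is compared with that of f n. Each of the two transforms doubles the
  error, and the final triangle inequality gives 2 * (2 * 2) + 2 = 10, independently of n.\<close>

lemma FT_invertible_limit:
  assumes f: "\<And>n. FT_invertible (f n)" "\<And>n. f n \<in> borel_measurable borel" "\<And>n. energy (f n) < \<infinity>"
    and fG: "(\<lambda>n. energy (\<lambda>x. f n x - G x)) \<longlonglongrightarrow> 0"
  shows "FT_invertible G"
  unfolding FT_invertible_def
proof (intro allI impI)
  fix H assume GH: "L2_FT G H"
  note [measurable] = L2_FT_measurable[OF GH] f(2)
  obtain U where U: "L2_FT H U"
    using L2_FT_exists[of H] L2_FT_measurable[OF GH] L2_FT_finite[OF GH] by auto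
  note [measurable] = L2_FT_measurable[OF U]
  have le: "energy (\<lambda>t. U t - G (- t)) \<le> 10 * energy (\<lambda>x. f n x - G x)" for n
  proof -
    obtain h where h: "L2_FT (f n) h" using L2_FT_exists[of "f n"] f by auto
    then have h': "L2_FT h (\<lambda>t. f n (- t))" using f(1) by (auto simp: FT_invertible_def)
    note [measurable] = L2_FT_measurable[OF h]
    have "energy (\<lambda>t. U t - G (- t))
        \<le> 2 * energy (\<lambda>t. U t - f n (- t)) + 2 * energy (\<lambda>t. f n (- t) - G (- t))"
      by (rule energy_triangle) auto
    also have "energy (\<lambda>t. f n (- t) - G (- t)) = energy (\<lambda>t. f n t - G t)"
      by (rule energy_reflect[of "\<lambda>t. f n t - G t"]) simp
    also have "energy (\<lambda>t. U t - f n (- t)) \<le> 2 * energy (\<lambda>x. H x - h x)"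
      by (rule L2_FT_energy_le[OF L2_FT_diff[OF U h']])
    also have "energy (\<lambda>x. H x - h x) \<le> 2 * energy (\<lambda>x. G x - f n x)"
      by (rule L2_FT_energy_le[OF L2_FT_diff[OF GH h]])
    finally have "energy (\<lambda>t. U t - G (- t))
        \<le> 2 * (2 * (2 * energy (\<lambda>x. f n x - G x))) + 2 * energy (\<lambda>x. f n x - G x)"
      by (simp add: energy_diff_commute[of G] mult_left_mono)
    also have "\<dots> = 10 * energy (\<lambda>x. f n x - G x)"
      by (simp flip: mult.assoc distrib_right)
    finally show ?thesis .
  qed
  have "(\<lambda>n. 10 * energy (\<lambda>x. f n x - G x)) \<longlonglongrightarrow> 0"
    using ennreal_tendsto_cmult[OF _ fG, of 10] by simp
  then have "energy (\<lambda>t. U t - G (- t)) \<le> 0"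
    by (rule LIMSEQ_le_const) (use le in auto)
  then have "AE t in lborel. U t = G (- t)"
    by (simp add: energy_eq_0_iff)
  then show "L2_FT H (\<lambda>t. G (- t))"
    by (intro L2_FT_cong_AE[OF U]) auto
qed

lemma energy_bounded_support:
  fixes M R :: real
  assumes "\<And>t. norm (G t) \<le> M * indicator {-R..R} t"
  shows "energy G < \<infinity>"
proof -
  have "energy G \<le> (\<integral>\<^sup>+ t. ennreal (M\<^sup>2) * indicator {-R..R} t \<partial>lborel)"
    unfolding energy_def
  proof (rule nn_integral_mono)
    fix t
    have "(norm (G t))\<^sup>2 \<le> (M * indicator {-R..R} t)\<^sup>2"
      by (intro power_mono assms) auto
    from ennreal_leI[OF this] show "ennreal ((norm (G t))\<^sup>2) \<le> ennreal (M\<^sup>2) * indicator {-R..R} t"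
      by (auto split: split_indicator_asm)
  qed
  also have "\<dots> < \<infinity>"
    by (simp add: nn_integral_cmult emeasure_lborel_Icc_eq ennreal_mult_less_top)
  finally show ?thesis .
qed

lemma L12_bounded_support:
  fixes M R :: real
  assumes [measurable]: "G \<in> borel_measurable borel"
    and G: "\<And>t. norm (G t) \<le> M * indicator {-R..R} t"
  shows "L12 G"
proof -
  have "G t = truncate R G t" for t
    using G[of t] by (auto simp: truncate_def split: split_indicator_asm)
  then have "G = truncate R G" by blast
  then show ?thesis
    using L12_truncate[of G R] energy_bounded_support[of G M R] G by auto
qed

lemma FT_invertible_bounded_support:
  fixes M R :: real
  assumes [measurable]: "G \<in> borel_measurable borel" and M: "M > 0"
    and G: "\<And>t. norm (G t) \<le> M * indicator {-R..R} t"
  shows "FT_invertible G"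
proof -
  have "G \<in> borel_measurable lebesgue" by (intro measurable_completion) simp
  \<comment> \<open>This notion of measurability means being a limit of continuous functions off a
    negligible set, which supplies the approximants.\<close>
  then have "G measurable_on UNIV"
    by (intro lebesgue_measurable_imp_measurable_on) auto
  then obtain N g where N: "negligible N" and g: "\<And>n. continuous_on UNIV (g n)"
    and gG: "\<And>t. t \<notin> N \<Longrightarrow> (\<lambda>n. g n t) \<longlonglongrightarrow> G t"
    unfolding measurable_on_def by auto
  \<comment> \<open>The approximants are tamed without losing continuity: p retracts the plane
    radially onto the disc of radius M, and k is 1 on [-R, R] and vanishes from distance R + 1 on.
    Both leave G unchanged, so the limit is preserved.\<close>
  define p where "p z = (M / max M (norm z)) *\<^sub>R z" for z :: complex
  define k where "k t = max 0 (1 - max 0 (\<bar>t\<bar> - R))" for t :: real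
  have max0: "max M (norm z) \<noteq> 0" for z :: complex using M by auto
  have p: "continuous_on UNIV p"
    unfolding p_def using max0 by (intro continuous_intros) auto
  have norm_p: "norm (p z) \<le> M" for z
  proof -
    have "M * norm z \<le> M * max M (norm z)" using M by (intro mult_left_mono) auto
    then show ?thesis using M by (simp add: p_def divide_simps)
  qed
  have p_id: "p z = z" if "norm z \<le> M" for z
    using that M by (simp add: p_def max_def)
  have k: "continuous_on UNIV k" unfolding k_def by (intro continuous_intros)
  define f where "f n t = k t *\<^sub>R p (g n t)" for n t
  have f_cont: "continuous_on UNIV (f n)" for n
    unfolding f_def
    by (intro continuous_intros k continuous_on_compose2[OF p g]) auto
  have [measurable]: "f n \<in> borel_measurable borel" for n
    using f_cont by (rule borel_measurable_continuous_onI)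
  have f_le: "norm (f n t) \<le> M * indicator {-(R+1)..R+1} t" for n t
  proof -
    have "norm (f n t) \<le> k t * M"
      unfolding f_def using norm_p[of "g n t"] by (simp add: mult_left_mono k_def)
    have "k t \<le> indicator {-(R+1)..R+1} t"
      by (auto simp: k_def indicator_def)
    then have "k t * M \<le> indicator {-(R+1)..R+1} t * M"
      using M by (intro mult_right_mono) auto
    with \<open>norm (f n t) \<le> k t * M\<close> show ?thesis by (simp only: mult.commute[of M])
  qed
  have f_bound: "norm (f n t) \<le> M" for n t
    using f_le[of n t] M by (auto split: split_indicator_asm)
  have L: "L12 (f n)" for n by (rule L12_bounded_support[OF _ f_le]) simp
  have G_lim: "k t *\<^sub>R p (G t) = G t" for t
    using G[of t] M by (auto simp: p_id k_def split: split_indicator_asm)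
  have "(\<lambda>n. energy (\<lambda>x. f n x - G x)) \<longlonglongrightarrow> 0"
  proof (rule energy_dominated_convergence[where d="\<lambda>t. of_real (M * indicator {-(R+1)..R+1} t)"])
    show "energy (\<lambda>t. complex_of_real (M * indicator {-(R+1)..R+1} t)) < \<infinity>"
      by (rule energy_bounded_support[of _ M "R + 1"]) (use M in \<open>auto simp: norm_mult\<close>)
    have "N \<in> null_sets lebesgue"
      using N by (simp add: negligible_iff_null_sets)
    then have "AE t in lebesgue. t \<notin> N" by (rule AE_not_in)
    then have "AE t in lborel. t \<notin> N" by (simp add: AE_completion_iff)
    then show "AE t in lborel. (\<lambda>n. f n t) \<longlonglongrightarrow> G t"
    proof eventually_elim
      case (elim t)
      have "isCont p (G t)" using p by (simp add: continuous_on_eq_continuous_at)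
      from isCont_tendsto_compose[OF this gG[OF elim]]
      have "(\<lambda>n. f n t) \<longlonglongrightarrow> k t *\<^sub>R p (G t)"
        unfolding f_def by (intro tendsto_intros)
      then show ?case by (simp add: G_lim)
    qed
  next
    show "AE t in lborel. norm (f n t) \<le> norm (complex_of_real (M * indicator {-(R+1)..R+1} t))" for n
      using f_le[of n] M by (intro AE_I2) (simp only: norm_of_real abs_of_nonneg mult_nonneg_nonneg less_imp_le indicator_pos_le)
  qed measurable
  moreover have "FT_invertible (f n)" for n
    by (rule FT_invertible_continuous[OF f_cont f_bound L])
  ultimately show ?thesis
    using FT_invertible_limit[of f G] L by (simp add: L12_def)
qed

lemma FT_invertible_L2:
  assumes [measurable]: "G \<in> borel_measurable borel" and fin: "energy G < \<infinity>"
  shows "FT_invertible G"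
proof -
  define f where "f n t = (if norm (G t) \<le> real n then truncate (real n) G t else 0)" for n t
  have [measurable]: "f n \<in> borel_measurable borel" for n
    unfolding f_def by measurable
  \<comment> \<open>The bound n + 1 in place of n is positive also for n = 0, as the bounded case
    requires.\<close>
  have f_le: "norm (f n t) \<le> (real n + 1) * indicator {- real n..real n} t" for n t
    by (auto simp: f_def truncate_def split: split_indicator)
  have f_le_G: "norm (f n t) \<le> norm (G t)" for n t
    by (simp add: f_def norm_truncate_le)
  have inv: "FT_invertible (f n)" for n
    by (rule FT_invertible_bounded_support[OF _ _ f_le]) auto
  have lim: "(\<lambda>n. f n t) \<longlonglongrightarrow> G t" for t
  proof (rule tendsto_eventually)
    obtain N :: nat where N: "max (norm (G t)) \<bar>t\<bar> \<le> real N" using real_arch_simple by blast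
    have "f n t = G t" if "n \<ge> N" for n
    proof -
      have "norm (G t) \<le> real n" "\<bar>t\<bar> \<le> real n" using N that by auto
      then show ?thesis by (auto simp: f_def truncate_def indicator_def)
    qed
    then show "\<forall>\<^sub>F n in sequentially. f n t = G t"
      unfolding eventually_sequentially by blast
  qed
  have "(\<lambda>n. energy (\<lambda>x. f n x - G x)) \<longlonglongrightarrow> 0"
    by (rule energy_dominated_convergence[where d=G, OF _ _ _ AE_I2[OF lim] AE_I2[OF f_le_G] fin]) auto
  then show ?thesis
    using order.strict_trans1[OF energy_mono[OF f_le_G] fin] inv FT_invertible_limit[of f G] by simp
qed

text \<open>Transforming twice gives the reflection. For the converse, inversion of the hypothesis
  relates the reflection of G to that of H, and reflecting both sides finishes.\<close>

theorem L2_FT_inverse_iff: "L2_FT H (\<lambda>t. G (- t)) \<longleftrightarrow> L2_FT G H"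
proof
  have inv: "L2_FT H (\<lambda>t. G (- t))" if "L2_FT G H" for G H
    using FT_invertible_L2 L2_FT_finite(1)[OF that] L2_FT_measurable(1)[OF that] that
    by (auto simp: FT_invertible_def)
  show "L2_FT G H" if "L2_FT H (\<lambda>t. G (- t))"
    using L2_FT_reflect[OF inv[OF that]] by simp
  show "L2_FT H (\<lambda>t. G (- t))" if "L2_FT G H"
    using that by (rule inv)
qed

text \<open>Both sides depend continuously on G: on the left by Young's inequality, on the right
  because the transform of the kernel is bounded by its integral. So the L^1 case passes to the
  limit along truncations.\<close>

lemma (in convolution_kernel) L2_FT_convolve:
  assumes GH: "L2_FT G H"
  shows "L2_FT (convolve K G) (\<lambda>x. (\<integral>t. iexp (- (x * t)) * of_real (K t) \<partial>lborel) * H x)"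
proof -
  note [measurable] = L2_FT_measurable[OF GH]
  note fin = L2_FT_finite(1)[OF GH]
  define k where "k x = (\<integral>t. iexp (- (x * t)) * of_real (K t) \<partial>lborel)" for x
  define I where "I = (\<integral>t. K t \<partial>lborel)"
  have [measurable]: "k \<in> borel_measurable borel"
    unfolding k_def by measurable
  have k_le: "norm (k x) \<le> I" for x
  proof -
    have "norm (k x) \<le> (\<integral>t. norm (iexp (- (x * t)) * of_real (K t)) \<partial>lborel)"
      unfolding k_def by (rule integral_norm_bound)
    also have "\<dots> = I"
      by (simp add: norm_mult kernel_nonneg I_def del: of_real_mult of_real_minus)
    finally show ?thesis .
  qed
  have I: "0 \<le> I" using k_le[of 0] norm_ge_zero order_trans by blast
  define f where "f n = truncate (real n) G" for n
  have f: "L12 (f n)" for n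
    unfolding f_def by (rule L12_truncate) (use fin in auto)
  note [measurable] = L12_measurable[OF f]
  have fG: "(\<lambda>n. energy (\<lambda>x. f n x - G x)) \<longlonglongrightarrow> 0"
    unfolding f_def
    by (rule filterlim_compose[OF tendsto_energy_truncate filterlim_real_sequentially]) (use fin in auto)
  have finC: "energy (convolve K g) < \<infinity>" if "energy g < \<infinity>" "g \<in> borel_measurable borel" for g
    by (rule order.strict_trans1[OF energy_convolve_le[OF that(2)]])
      (use that(1) in \<open>simp add: ennreal_mult_less_top\<close>)
  have "L2_FT (convolve K G) (\<lambda>x. k x * H x)"
  proof (rule L2_FT_limitI[where f="\<lambda>n. convolve K (f n)"])
    show "L12 (convolve K (f n))" for n
      using f[of n] integrable_convolve finC[of "f n"] by (auto simp: L12_def)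
    show "energy (convolve K G) < \<infinity>" using finC fin by simp
    show "(\<lambda>n. energy (\<lambda>t. convolve K (f n) t - convolve K G t)) \<longlonglongrightarrow> 0"
    proof (rule tendsto_sandwich[where f="\<lambda>_. 0"])
      show "(\<lambda>n. ennreal (I\<^sup>2) * energy (\<lambda>x. f n x - G x)) \<longlonglongrightarrow> 0"
        using ennreal_tendsto_cmult[OF _ fG, of "ennreal (I\<^sup>2)"] by simp
      have "energy (\<lambda>t. convolve K (f n) t - convolve K G t) \<le> ennreal (I\<^sup>2) * energy (\<lambda>x. f n x - G x)" for n
      proof -
        have "energy (\<lambda>t. convolve K (f n) t - convolve K G t) = energy (convolve K (\<lambda>x. f n x - G x))"
        proof (rule energy_cong_AE)
          have "energy (f n) < \<infinity>" using f by (simp add: L12_def)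
          with AE_integrable_convolve[of "f n"] AE_integrable_convolve[of G] fin
          show "AE t in lborel. convolve K (f n) t - convolve K G t = convolve K (\<lambda>x. f n x - G x) t"
            by (auto simp: convolve_def right_diff_distrib)
        qed
        also have "\<dots> \<le> ennreal (I\<^sup>2) * energy (\<lambda>x. f n x - G x)"
          unfolding I_def by (rule energy_convolve_le) simp
        finally show ?thesis .
      qed
      then show "\<forall>\<^sub>F n in sequentially. energy (\<lambda>t. convolve K (f n) t - convolve K G t)
          \<le> ennreal (I\<^sup>2) * energy (\<lambda>x. f n x - G x)" by simp
    qed auto
    show "(\<lambda>n. energy (\<lambda>x. FT (convolve K (f n)) x - k x * H x)) \<longlonglongrightarrow> 0"
    proof (rule tendsto_sandwich[where f="\<lambda>_. 0"])
      show "(\<lambda>n. ennreal (I\<^sup>2) * energy (\<lambda>x. FT (f n) x - H x)) \<longlonglongrightarrow> 0"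
        using ennreal_tendsto_cmult[OF _ L2_FT_limit[OF f GH fG], of "ennreal (I\<^sup>2)"] by simp
      have "energy (\<lambda>x. FT (convolve K (f n)) x - k x * H x)
          \<le> ennreal (I\<^sup>2) * energy (\<lambda>x. FT (f n) x - H x)" for n
      proof -
        have "FT (convolve K (f n)) x - k x * H x = k x * (FT (f n) x - H x)" for x
          using FT_convolve[of "f n" x] f[of n] by (simp add: L12_def k_def right_diff_distrib)
        then have "energy (\<lambda>x. FT (convolve K (f n)) x - k x * H x)
            \<le> energy (\<lambda>x. of_real I * (FT (f n) x - H x))"
          using k_le I by (intro energy_mono) (auto simp: norm_mult intro!: mult_right_mono)
        also have "\<dots> = ennreal (I\<^sup>2) * energy (\<lambda>x. FT (f n) x - H x)"
          using I by (subst energy_cmult) auto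
        finally show ?thesis .
      qed
      then show "\<forall>\<^sub>F n in sequentially. energy (\<lambda>x. FT (convolve K (f n)) x - k x * H x)
          \<le> ennreal (I\<^sup>2) * energy (\<lambda>x. FT (f n) x - H x)" by simp
    qed auto
  qed (auto intro: borel_measurable_kernel)
  then show ?thesis by (simp add: k_def)
qed

section \<open>The Laplace transform of powers\<close>

definition gamma_weight :: "real \<Rightarrow> real \<Rightarrow> real \<Rightarrow> real" where
  "gamma_weight s b t = indicator {0<..} t * (t powr (s - 1) * exp (- (b * t)))"

lemma borel_measurable_gamma_weight [measurable]: "gamma_weight s b \<in> borel_measurable borel"
  unfolding gamma_weight_def by measurable

lemma gamma_weight_nonneg: "0 \<le> gamma_weight s b t"
  by (simp add: gamma_weight_def)

lemma has_bochner_integral_gamma_weight: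
  assumes s: "s > 0" and b: "b > 0"
  shows "has_bochner_integral lborel (gamma_weight s b) (Gamma s / b powr s)"
proof (rule has_bochner_integral_nn_integral)
  have "(\<integral>\<^sup>+ t. ennreal (gamma_weight s b t) \<partial>lborel)
      = (\<integral>\<^sup>+ t. ennreal (b powr (1 - s)) * ennreal (indicator {0..} (b * t) * (b * t) powr (s - 1) / exp (b * t)) \<partial>lborel)"
  proof (intro nn_integral_cong)
    fix t :: real
    show "ennreal (gamma_weight s b t)
        = ennreal (b powr (1 - s)) * ennreal (indicator {0..} (b * t) * (b * t) powr (s - 1) / exp (b * t))"
    proof (cases "t > 0")
      case True
      then have "(b * t) powr (s - 1) = b powr (s - 1) * t powr (s - 1)" "b powr (1 - s) * b powr (s - 1) = 1"
        using b by (auto simp: powr_mult simp flip: powr_add)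
      then show ?thesis
        using True b by (simp add: gamma_weight_def exp_minus field_simps flip: ennreal_mult mult.assoc)
    next
      case False
      \<comment> \<open>At t = 0 the two indicators differ, but \<open>0 powr (s - 1)\<close> is
        0.\<close>
      then have "t = 0 \<or> t < 0" by auto
      then show ?thesis using b by (auto simp: gamma_weight_def indicator_def mult_le_0_iff zero_le_mult_iff)
    qed
  qed
  also have "\<dots> = ennreal (b powr (1 - s)) * (\<integral>\<^sup>+ t. ennreal (indicator {0..} (b * t) * (b * t) powr (s - 1) / exp (b * t)) \<partial>lborel)"
    by (rule nn_integral_cmult) measurable
  \<comment> \<open>A factor b is split off to serve as the Jacobian of the substitution of b t in
    Euler's integral.\<close>
  also have "\<dots> = ennreal (b powr (1 - s) / b) * (ennreal b * (\<integral>\<^sup>+ t. ennreal (indicator {0..} (0 + b * t) * (0 + b * t) powr (s - 1) / exp (0 + b * t)) \<partial>lborel))"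
    using b by (simp flip: ennreal_mult mult.assoc)
  also have "ennreal b * (\<integral>\<^sup>+ t. ennreal (indicator {0..} (0 + b * t) * (0 + b * t) powr (s - 1) / exp (0 + b * t)) \<partial>lborel)
      = (\<integral>\<^sup>+ t. ennreal (indicator {0..} t * t powr (s - 1) / exp t) \<partial>lborel)"
    using b by (subst nn_integral_real_affine[where c=b and t=0]) auto
  also have "\<dots> = ennreal (Gamma s)"
    using Gamma_conv_nn_integral_real[OF s] by simp
  also have "ennreal (b powr (1 - s) / b) * ennreal (Gamma s) = ennreal (Gamma s / b powr s)"
    using b s by (simp add: powr_diff field_simps flip: ennreal_mult)
  finally show "(\<integral>\<^sup>+ t. ennreal (gamma_weight s b t) \<partial>lborel) = ennreal (Gamma s / b powr s)" .
qed (use b s in \<open>auto simp: gamma_weight_nonneg\<close>)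

lemma gamma_weight_add_nat: "gamma_weight (s + real n) b t = gamma_weight s b t * t ^ n"
proof (cases "t > 0")
  case True
  then have "t powr (s + real n - 1) = t powr (s - 1) * t ^ n"
    by (simp add: powr_realpow[symmetric] algebra_simps flip: powr_add)
  then show ?thesis by (simp add: gamma_weight_def)
qed (simp add: gamma_weight_def)

text \<open>The condition |b - z| < b is equivalent to b > |z|^2 / (2 Re z); the witness is twice
  this threshold.\<close>

lemma exists_disc_center:
  fixes z :: complex
  assumes "Re z > 0"
  obtains b :: real where "b > 0" "norm (of_real b - z) < b"
proof
  define b where "b = (norm z)\<^sup>2 / Re z"
  have z: "norm z > 0" using assms by auto
  show b: "b > 0" using z assms by (simp add: b_def)
  have "(norm (of_real b - z))\<^sup>2 = b\<^sup>2 - 2 * (b * Re z) + (norm z)\<^sup>2"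
    unfolding cmod_power2 by (simp add: power2_diff algebra_simps) 
  also have "b * Re z = (norm z)\<^sup>2" using assms by (simp add: b_def)
  also have "b\<^sup>2 - 2 * (norm z)\<^sup>2 + (norm z)\<^sup>2 < b\<^sup>2" using z by simp
  finally show "norm (of_real b - z) < b"
    using b by (simp add: power2_less_imp_less)
qed

text \<open>Expanding the exponential about a large real point b makes the integral a binomial series in
  (b - z) / b, which converges since |b - z| < b; this replaces analytic continuation in z.\<close>

lemma Gamma_Laplace_integral:
  assumes a: "a > 0" and rho: "Re z > 0"
  shows "(\<integral>t. of_real (gamma_weight a 0 t) * exp (- (z * of_real t)) \<partial>lborel)
    = of_real (Gamma a) * z powr (- of_real a)"
proof -
  obtain b where b: "b > 0" "norm (of_real b - z) < b"
    using exists_disc_center[OF rho] by blast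
  define w where "w = of_real b - z"
  define p where "p n = pochhammer a n / fact n" for n
  define f where "f n t = of_real (gamma_weight (a + real n) b t) * (w ^ n / fact n)" for n t
  \<comment> \<open>The \<open>p n\<close> are the coefficients of the binomial series of (1 - u) to
    the power - a; the sign of the generalised binomial coefficient cancels that of - u.\<close>
  have binom: "(of_real (- a) gchoose n) * (- u) ^ n = of_real (p n) * u ^ n" for n and u :: complex
  proof -
    have "((-1) ^ n * (-1) ^ n :: complex) = 1" by (simp flip: power_mult_distrib)
    then have *: "(-1) ^ n * x * ((-1) ^ n * y) = x * y" for x y :: complex
      by (metis mult.assoc mult.left_commute mult.left_neutral)
    show ?thesis
      unfolding gbinomial_pochhammer power_minus[of u]
      using *[of "pochhammer (of_real a) n / fact n" "u ^ n"] by (simp add: p_def pochhammer_of_real)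
  qed
  have int: "has_bochner_integral lborel (\<lambda>t. gamma_weight (a + real n) b t)
      (Gamma a * b powr (- a) * (pochhammer a n / b ^ n))" for n
  proof -
    have "Gamma (a + real n) = pochhammer a n * Gamma a"
      using a less_imp_neq[OF Gamma_real_pos[OF a]]
      by (subst pochhammer_Gamma) (auto elim!: nonpos_Ints_cases)
    then have "Gamma (a + real n) / b powr (a + real n) = Gamma a * b powr (- a) * (pochhammer a n / b ^ n)"
      using b by (simp add: powr_add powr_realpow powr_minus field_simps)
    then show ?thesis
      using has_bochner_integral_gamma_weight[of "a + real n" b] a b by simp
  qed
  have f_int: "integrable lborel (f n)" for n
    unfolding f_def using int[of n] by (auto simp: has_bochner_integral_iff)
  have f_val: "(\<integral>t. f n t \<partial>lborel) = of_real (Gamma a * b powr (- a)) * (of_real (p n) * (w / of_real b) ^ n)" for n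
    unfolding f_def using int[of n] by (simp add: has_bochner_integral_iff p_def power_divide mult_ac)
  have norm_f: "norm (f n t) = gamma_weight (a + real n) b t * (norm w ^ n / fact n)" for n t
    by (simp add: f_def norm_mult norm_divide norm_power gamma_weight_nonneg)
  have f_norm: "(\<integral>t. norm (f n t) \<partial>lborel) = Gamma a * b powr (- a) * (p n * (norm w / b) ^ n)" for n
    unfolding norm_f using int[of n] by (simp add: has_bochner_integral_iff p_def power_divide mult_ac)
  \<comment> \<open>At the point - norm w / b the same series has nonnegative terms, so its
    convergence is the absolute convergence that termwise integration requires.\<close>
  have "summable (\<lambda>n. complex_of_real (p n * (norm w / b) ^ n))"
    using gen_binomial_complex[of "- of_real (norm w / b)" "of_real (- a)"] b
    unfolding binom by (auto simp: w_def norm_divide dest: sums_summable)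
  then have summ: "summable (\<lambda>n. \<integral>t. norm (f n t) \<partial>lborel)"
    unfolding f_norm by (intro summable_mult) (simp only: summable_complex_of_real)
  have exp_sums: "(\<lambda>n. f n t) sums (of_real (gamma_weight a b t) * exp (w * of_real t))" for t
  proof -
    have "f n t = of_real (gamma_weight a b t) * ((w * of_real t) ^ n /\<^sub>R fact n)" for n
      by (simp add: f_def gamma_weight_add_nat power_mult_distrib scaleR_conv_of_real field_simps)
    then show ?thesis
      using sums_mult[OF exp_converges[of "w * of_real t"]] by simp
  qed
  have norm_summ: "summable (\<lambda>n. norm (f n t))" for t
  proof -
    have "norm (f n t) = gamma_weight a b t * ((norm w * t) ^ n /\<^sub>R fact n)" for n
      by (simp add: norm_f gamma_weight_add_nat power_mult_distrib field_simps)
    then show ?thesis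
      using summable_mult[OF sums_summable[OF exp_converges[of "norm w * t"]]] by simp
  qed
  have "(\<lambda>n. \<integral>t. f n t \<partial>lborel) sums (\<integral>t. (\<Sum>n. f n t) \<partial>lborel)"
    by (rule sums_integral) (use f_int norm_summ summ in auto)
  also have "(\<lambda>t. \<Sum>n. f n t) = (\<lambda>t. of_real (gamma_weight a 0 t) * exp (- (z * of_real t)))"
  proof
    fix t
    have "(\<Sum>n. f n t) = of_real (gamma_weight a b t) * exp (w * of_real t)"
      using exp_sums by (rule sums_unique[symmetric])
    also have "\<dots> = of_real (gamma_weight a 0 t) * (exp (- (of_real b * of_real t)) * exp (w * of_real t))"
      by (simp add: gamma_weight_def flip: exp_of_real)
    also have "exp (- (of_real b * of_real t)) * exp (w * of_real t) = exp (- (z * of_real t))"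
      unfolding exp_add[symmetric] by (simp add: w_def algebra_simps)
    finally show "(\<Sum>n. f n t) = of_real (gamma_weight a 0 t) * exp (- (z * of_real t))" .
  qed
  finally have 1: "(\<lambda>n. \<integral>t. f n t \<partial>lborel) sums
      (\<integral>t. of_real (gamma_weight a 0 t) * exp (- (z * of_real t)) \<partial>lborel)" .
  have "(\<lambda>n. (of_real (- a) gchoose n) * (- (w / of_real b)) ^ n) sums (1 + - (w / of_real b)) powr of_real (- a)"
    using b by (intro gen_binomial_complex) (simp add: w_def norm_divide)
  then have "(\<lambda>n. \<integral>t. f n t \<partial>lborel) sums
      (of_real (Gamma a * b powr (- a)) * (1 + - (w / of_real b)) powr of_real (- a))"
    unfolding binom f_val by (rule sums_mult)
  with 1 have "(\<integral>t. of_real (gamma_weight a 0 t) * exp (- (z * of_real t)) \<partial>lborel)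
      = of_real (Gamma a * b powr (- a)) * (1 + - (w / of_real b)) powr of_real (- a)"
    by (rule sums_unique2)
  also have "1 + - (w / of_real b) = of_real (1 / b) * z"
    using b by (simp add: w_def field_simps)
  \<comment> \<open>The principal branch is multiplicative here because 1 / b is a positive
    real.\<close>
  also have "(of_real (1 / b) * z) powr of_real (- a) = of_real (1 / b) powr of_real (- a) * z powr of_real (- a)"
    using b by (intro powr_times_real_left) auto
  also have "complex_of_real (1 / b) powr of_real (- a) = of_real (b powr a)"
    using b by (subst powr_of_real) (auto simp: powr_minus powr_divide)
  also have "of_real (Gamma a * b powr (- a)) * (of_real (b powr a) * z powr of_real (- a))
      = of_real (Gamma a) * z powr (- of_real a)"
    using b by (simp add: powr_minus)
  finally show ?thesis .
qed

definition frac_kernel :: "real \<Rightarrow> real \<Rightarrow> real \<Rightarrow> real" where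
  "frac_kernel rho a t = gamma_weight a rho t / Gamma a"

lemma convolution_kernel_frac_kernel:
  assumes "a > 0" "rho > 0"
  shows "convolution_kernel (frac_kernel rho a)"
proof
  show "integrable lborel (frac_kernel rho a)"
    unfolding frac_kernel_def
    using has_bochner_integral_gamma_weight[OF assms] by (auto simp: has_bochner_integral_iff)
  show "0 \<le> frac_kernel rho a t" for t
    unfolding frac_kernel_def using assms gamma_weight_nonneg[of a rho t] by simp
qed

lemma integral_iexp_frac_kernel:
  assumes "a > 0" "rho > 0"
  shows "(\<integral>t. iexp (- (x * t)) * of_real (frac_kernel rho a t) \<partial>lborel) = Complex rho x powr of_real (- a)"
proof -
  have "(\<integral>t. iexp (- (x * t)) * of_real (frac_kernel rho a t) \<partial>lborel)
      = (\<integral>t. of_real (1 / Gamma a) * (of_real (gamma_weight a 0 t) * exp (- (Complex rho x * of_real t))) \<partial>lborel)"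
  proof (intro Bochner_Integration.integral_cong refl)
    fix t
    have "- (Complex rho x * of_real t) = \<i> * of_real (- (x * t)) + of_real (- (rho * t))"
      by (simp add: complex_eq_iff)
    then have "exp (- (Complex rho x * of_real t)) = iexp (- (x * t)) * of_real (exp (- (rho * t)))"
      by (simp only: exp_add exp_of_real)
    then show "iexp (- (x * t)) * of_real (frac_kernel rho a t)
        = of_real (1 / Gamma a) * (of_real (gamma_weight a 0 t) * exp (- (Complex rho x * of_real t)))"
      by (simp add: frac_kernel_def gamma_weight_def)
  qed
  also have "\<dots> = of_real (1 / Gamma a) * (of_real (Gamma a) * Complex rho x powr (- of_real a))"
    using Gamma_Laplace_integral[of a "Complex rho x"] assms by simp
  also have "\<dots> = Complex rho x powr of_real (- a)"
    using less_imp_neq[OF Gamma_real_pos[OF assms(1)]] by simp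
  finally show ?thesis .
qed

section \<open>Reduction to components\<close>

lemma borel_measurable_vec_iff:
  fixes f :: "'a \<Rightarrow> complex ^ 'n"
  shows "f \<in> borel_measurable M \<longleftrightarrow> (\<forall>k. (\<lambda>x. f x $ k) \<in> borel_measurable M)"
proof
  assume [measurable]: "f \<in> borel_measurable M"
  have "(\<lambda>v :: complex ^ 'n. v $ k) \<in> borel_measurable borel" for k
    by (intro borel_measurable_continuous_onI continuous_intros)
  from measurable_compose[OF _ this, of f M]
  show "\<forall>k. (\<lambda>x. f x $ k) \<in> borel_measurable M" by simp
next
  assume f: "\<forall>k. (\<lambda>x. f x $ k) \<in> borel_measurable M"
  have ax: "(axis k :: complex \<Rightarrow> complex ^ 'n) \<in> borel_measurable borel" for k
  proof (rule borel_measurable_continuous_onI)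
    have "continuous_on UNIV (\<lambda>z. (\<chi> j. if j = k then z else 0) :: complex ^ 'n)"
    proof (rule continuous_on_vec_lambda)
      show "continuous_on UNIV (\<lambda>z. if j = k then z else 0 :: complex)" for j
        by (cases "j = k") auto
    qed
    then show "continuous_on UNIV (axis k :: complex \<Rightarrow> complex ^ 'n)"
      by (simp add: axis_def[abs_def])
  qed
  have "f x = (\<Sum>k\<in>UNIV. axis k (f x $ k))" for x
    by (simp add: vec_eq_iff axis_def)
  then have "f = (\<lambda>x. \<Sum>k\<in>UNIV. axis k (f x $ k))" by blast
  moreover have "(\<lambda>x. \<Sum>k\<in>UNIV. axis k (f x $ k)) \<in> borel_measurable M"
    using f by (intro borel_measurable_sum measurable_compose[OF _ ax]) auto
  ultimately show "f \<in> borel_measurable M" by simp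
qed

lemma norm_vec_power2: "(norm v)\<^sup>2 = (\<Sum>k\<in>UNIV. (norm (v $ k))\<^sup>2)"
  by (simp add: norm_vec_def L2_set_def sum_nonneg)

lemma tendsto_sum_0_ennreal_iff:
  fixes a :: "'k::finite \<Rightarrow> 'b \<Rightarrow> ennreal"
  shows "((\<lambda>R. \<Sum>k\<in>UNIV. a k R) \<longlongrightarrow> 0) F \<longleftrightarrow> (\<forall>k. (a k \<longlongrightarrow> 0) F)"
proof
  assume lim: "((\<lambda>R. \<Sum>k\<in>UNIV. a k R) \<longlongrightarrow> 0) F"
  show "\<forall>k. (a k \<longlongrightarrow> 0) F"
  proof
    fix k
    show "(a k \<longlongrightarrow> 0) F"
      by (rule tendsto_sandwich[OF _ _ tendsto_const lim])
        (auto intro!: always_eventually member_le_sum)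
  qed
next
  assume "\<forall>k. (a k \<longlongrightarrow> 0) F"
  then have "((\<lambda>R. \<Sum>k\<in>UNIV. a k R) \<longlongrightarrow> (\<Sum>k\<in>(UNIV :: 'k set). 0)) F"
    by (intro tendsto_sum) auto
  then show "((\<lambda>R. \<Sum>k\<in>UNIV. a k R) \<longlongrightarrow> 0) F" by simp
qed

text \<open>The weight makes each component of an L^2_rho function an ordinary L^2 function with the
  same norm.\<close>

definition wcomp :: "real \<Rightarrow> (real \<Rightarrow> complex ^ 'n) \<Rightarrow> 'n \<Rightarrow> real \<Rightarrow> complex" where
  "wcomp rho g k t = of_real (exp (- (rho * t))) * g t $ k"

lemma borel_measurable_vec_iff_wcomp:
  "g \<in> borel_measurable borel \<longleftrightarrow> (\<forall>k. wcomp rho g k \<in> borel_measurable borel)"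
proof -
  have "(\<lambda>t. g t $ k) \<in> borel_measurable borel" if [measurable]: "wcomp rho g k \<in> borel_measurable borel" for k
  proof -
    have "(\<lambda>t. of_real (exp (rho * t)) * wcomp rho g k t) \<in> borel_measurable borel" by measurable
    then show ?thesis by (simp add: wcomp_def flip: mult.assoc of_real_mult exp_add)
  qed
  moreover have "wcomp rho g k \<in> borel_measurable borel"
    if [measurable]: "(\<lambda>t. g t $ k) \<in> borel_measurable borel" for k
    unfolding wcomp_def by measurable
  ultimately show ?thesis unfolding borel_measurable_vec_iff[of g] by blast
qed

lemma norm_weighted_power2:
  "(norm (g t))\<^sup>2 * exp (- 2 * rho * t) = (\<Sum>k\<in>UNIV. (norm (wcomp rho g k t))\<^sup>2)"
proof -
  have "exp (- 2 * rho * t) = (exp (- (rho * t)))\<^sup>2"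
    by (simp add: power2_eq_square flip: exp_add)
  then show ?thesis
    by (simp add: norm_vec_power2[of "g t"] wcomp_def norm_mult power_mult_distrib sum_distrib_left mult.commute)
qed

lemma nn_integral_weighted_norm:
  fixes g :: "real \<Rightarrow> complex ^ 'n"
  assumes g: "g \<in> borel_measurable borel"
  shows "(\<integral>\<^sup>+ t. ennreal ((norm (g t))\<^sup>2 * exp (- 2 * rho * t)) \<partial>lborel) = (\<Sum>k\<in>UNIV. energy (wcomp rho g k))"
proof -
  have [measurable]: "wcomp rho g k \<in> borel_measurable borel" for k
    using g borel_measurable_vec_iff_wcomp by blast
  have "(\<integral>\<^sup>+ t. ennreal ((norm (g t))\<^sup>2 * exp (- 2 * rho * t)) \<partial>lborel)
      = (\<integral>\<^sup>+ t. (\<Sum>k\<in>UNIV. ennreal ((norm (wcomp rho g k t))\<^sup>2)) \<partial>lborel)"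
    unfolding norm_weighted_power2 by (simp add: sum_ennreal)
  also have "\<dots> = (\<Sum>k\<in>UNIV. energy (wcomp rho g k))"
    unfolding energy_def by (rule nn_integral_sum) simp
  finally show ?thesis .
qed

lemma L2rho_iff:
  fixes g :: "real \<Rightarrow> complex ^ 'n"
  shows "L2rho rho g \<longleftrightarrow> (\<forall>k. wcomp rho g k \<in> borel_measurable borel \<and> energy (wcomp rho g k) < \<infinity>)"
proof (cases "g \<in> borel_measurable borel")
  case True
  note [measurable] = True
  have "integrable lborel (\<lambda>t. (norm (g t))\<^sup>2 * exp (- 2 * rho * t))
      \<longleftrightarrow> (\<integral>\<^sup>+ t. ennreal ((norm (g t))\<^sup>2 * exp (- 2 * rho * t)) \<partial>lborel) < \<infinity>"
    by (simp add: integrable_iff_bounded)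
  also have "\<dots> \<longleftrightarrow> (\<forall>k. energy (wcomp rho g k) < \<infinity>)"
    unfolding nn_integral_weighted_norm[OF True] by simp
  finally show ?thesis
    using True borel_measurable_vec_iff_wcomp[of g rho] by (simp add: L2rho_def)
qed (use borel_measurable_vec_iff_wcomp[of g rho] in \<open>auto simp: L2rho_def\<close>)

lemma exp_Complex_mult: "exp (Complex a b * of_real t) = of_real (exp (a * t)) * iexp (b * t)"
proof -
  have "Complex a b * of_real t = of_real (a * t) + \<i> * of_real (b * t)"
    by (simp add: complex_eq_iff)
  then show ?thesis by (simp only: exp_add exp_of_real)
qed

lemma FL_trunc_component: "FL_trunc rho g R xi $ k = FT (truncate R (wcomp rho g k)) xi"
proof -
  have "exp (- (Complex rho xi) * of_real t) = of_real (exp (- (rho * t))) * iexp (- (xi * t))" for t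
    using exp_Complex_mult[of "- rho" "- xi" t] by (simp add: Complex_eq)
  then show ?thesis
    unfolding FL_trunc_def FT_def set_lebesgue_integral_def truncate_def wcomp_def
    by (simp add: mult_ac)
qed

text \<open>The opposite sign in the exponent shows up as evaluation at - t, and the weight cancels
  the growth factor exp (rho t).\<close>

lemma FLinv_trunc_component:
  "of_real (exp (- (rho * t))) * FLinv_trunc rho h R t $ k = FT (truncate R (\<lambda>x. h x $ k)) (- t)"
proof -
  let ?J = "\<integral>x. iexp (- (- t * x)) * (indicator {-R..R} x *\<^sub>R h x $ k) \<partial>lborel"
  have "(LINT x:{-R..R}|lborel. exp (Complex rho x * of_real t) * h x $ k)
      = (\<integral>x. of_real (exp (rho * t)) * (iexp (- (- t * x)) * (indicator {-R..R} x *\<^sub>R h x $ k)) \<partial>lborel)"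
    unfolding exp_Complex_mult set_lebesgue_integral_def
    by (intro Bochner_Integration.integral_cong refl) (simp add: mult_ac)
  also have "\<dots> = of_real (exp (rho * t)) * ?J" by (rule integral_mult_right_zero)
  finally have "of_real (exp (- (rho * t))) * FLinv_trunc rho h R t $ k
      = of_real (exp (- (rho * t)) * exp (rho * t)) * (of_real (1 / sqrt (2 * pi)) * ?J)"
    by (simp add: FLinv_trunc_def)
  also have "exp (- (rho * t)) * exp (rho * t) = 1" by (simp flip: exp_add)
  finally show ?thesis by (simp add: FT_def truncate_def)
qed

lemma is_FL_iff:
  fixes g :: "real \<Rightarrow> complex ^ 'n"
  shows "is_FL rho g h \<longleftrightarrow> (\<forall>k. L2_FT (wcomp rho g k) (\<lambda>x. h x $ k))"
proof (cases "L2rho rho g \<and> h \<in> borel_measurable borel")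
  case True
  then have wg: "wcomp rho g k \<in> borel_measurable borel" "energy (wcomp rho g k) < \<infinity>"
    and h: "(\<lambda>x. h x $ k) \<in> borel_measurable borel" for k
    using L2rho_iff[of rho g] borel_measurable_vec_iff[of h] by auto
  note [measurable] = wg(1) h
  have "(\<integral>\<^sup>+ x. ennreal ((norm (FL_trunc rho g R x - h x))\<^sup>2) \<partial>lborel)
      = (\<Sum>k\<in>UNIV. energy (\<lambda>x. FT (truncate R (wcomp rho g k)) x - h x $ k))" for R
  proof -
    have "(\<lambda>x. FL_trunc rho g R x - h x) \<in> borel_measurable borel"
      unfolding borel_measurable_vec_iff[of "\<lambda>x. FL_trunc rho g R x - h x"]
      by (simp add: FL_trunc_component)
    \<comment> \<open>The Fourier side carries no weight, which is the weighted norm formula at rho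
      = 0.\<close>
    from nn_integral_weighted_norm[OF this, of 0] show ?thesis
      by (simp add: wcomp_def[of 0, abs_def] FL_trunc_component)
  qed
  then show ?thesis
    using True wg by (simp add: is_FL_def L2_FT_def tendsto_sum_0_ennreal_iff h)
next
  case False
  then show ?thesis
    using L2rho_iff[of rho g] borel_measurable_vec_iff[of h borel] by (auto simp: is_FL_def L2_FT_def)
qed

text \<open>Componentwise the adjoint is the transform followed by reflection, so by inversion u is
  the adjoint image of h exactly when h is the transform of u.\<close>

lemma is_FLadj_iff:
  fixes u :: "real \<Rightarrow> complex ^ 'n"
  shows "is_FLadj rho h u \<longleftrightarrow> (\<forall>k. L2_FT (wcomp rho u k) (\<lambda>x. h x $ k))"
proof -
  have w0: "wcomp 0 h k = (\<lambda>x. h x $ k)" for k by (simp add: wcomp_def fun_eq_iff)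
  have L2h: "h \<in> borel_measurable borel \<and> integrable lborel (\<lambda>x. (norm (h x))\<^sup>2)
      \<longleftrightarrow> (\<forall>k. (\<lambda>x. h x $ k) \<in> borel_measurable borel \<and> energy (\<lambda>x. h x $ k) < \<infinity>)"
    using L2rho_iff[of 0 h] by (simp add: L2rho_def w0)
  have "is_FLadj rho h u \<longleftrightarrow> (\<forall>k. L2_FT (\<lambda>x. h x $ k) (\<lambda>t. wcomp rho u k (- t)))"
  proof (cases "h \<in> borel_measurable borel \<and> integrable lborel (\<lambda>x. (norm (h x))\<^sup>2)
      \<and> u \<in> borel_measurable borel")
    case True
    then have u: "wcomp rho u k \<in> borel_measurable borel"
      and h: "(\<lambda>x. h x $ k) \<in> borel_measurable borel" "energy (\<lambda>x. h x $ k) < \<infinity>" for k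
      using L2h borel_measurable_vec_iff_wcomp[of u rho] by auto
    note [measurable] = u h(1)
    have wd: "wcomp rho (\<lambda>t. FLinv_trunc rho h R t - u t) k t
        = FT (truncate R (\<lambda>x. h x $ k)) (- t) - wcomp rho u k t" for R k t
      unfolding FLinv_trunc_component[of rho t, symmetric] by (simp add: wcomp_def right_diff_distrib)
    have "(\<integral>\<^sup>+ t. ennreal ((norm (FLinv_trunc rho h R t - u t))\<^sup>2 * exp (- 2 * rho * t)) \<partial>lborel)
        = (\<Sum>k\<in>UNIV. energy (\<lambda>t. FT (truncate R (\<lambda>x. h x $ k)) t - wcomp rho u k (- t)))" for R
    proof -
      have m: "(\<lambda>t. FLinv_trunc rho h R t - u t) \<in> borel_measurable borel"
        unfolding borel_measurable_vec_iff_wcomp[of "\<lambda>t. FLinv_trunc rho h R t - u t" rho] wd[abs_def]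
        by measurable
      have "energy (wcomp rho (\<lambda>t. FLinv_trunc rho h R t - u t) k)
          = energy (\<lambda>t. FT (truncate R (\<lambda>x. h x $ k)) t - wcomp rho u k (- t))" for k
        unfolding wd[abs_def]
        using energy_reflect[of "\<lambda>t. FT (truncate R (\<lambda>x. h x $ k)) t - wcomp rho u k (- t)"] by simp
      then show ?thesis using nn_integral_weighted_norm[OF m] by simp
    qed
    then show ?thesis
      using True h by (simp add: is_FLadj_def L2_FT_def tendsto_sum_0_ennreal_iff)
  next
    case False
    \<comment> \<open>If a side condition fails, the relation must fail too: it forces h to be
      square integrable, and after inversion it forces the weighted components of u to be
      measurable.\<close>
    have "\<not> (\<forall>k. L2_FT (\<lambda>x. h x $ k) (\<lambda>t. wcomp rho u k (- t)))"
    proof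
      assume *: "\<forall>k. L2_FT (\<lambda>x. h x $ k) (\<lambda>t. wcomp rho u k (- t))"
      then have "L2_FT (wcomp rho u k) (\<lambda>x. h x $ k)" for k
        by (simp add: L2_FT_inverse_iff)
      then have "u \<in> borel_measurable borel"
        unfolding borel_measurable_vec_iff_wcomp[of u rho] using L2_FT_measurable(1) by blast
      moreover have "\<forall>k. (\<lambda>x. h x $ k) \<in> borel_measurable borel \<and> energy (\<lambda>x. h x $ k) < \<infinity>"
        using * L2_FT_measurable(1) L2_FT_finite(1) by blast
      ultimately show False using False L2h by blast
    qed
    moreover have "\<not> is_FLadj rho h u" using False by (auto simp: is_FLadj_def)
    ultimately show ?thesis by blast
  qed
  then show ?thesis by (simp add: L2_FT_inverse_iff)
qed

section \<open>Fractional powers of the derivative on the Fourier side\<close>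

lemma frac_deriv_iff:
  fixes g u :: "real \<Rightarrow> complex ^ 'n"
  shows "frac_deriv rho gam g u \<longleftrightarrow> (\<exists>h :: real \<Rightarrow> complex ^ 'n. \<forall>k. L2_FT (wcomp rho g k) (\<lambda>x. h x $ k) \<and>
    L2_FT (wcomp rho u k) (\<lambda>x. Complex rho x powr of_real gam * h x $ k))"
  unfolding frac_deriv_def is_FL_iff is_FLadj_iff by (auto simp: cscale_def)

text \<open>The two multipliers cancel because rho + i x has positive real part and so is never 0.
  The requirement that both Fourier sides be square integrable is part of the relation, hence the
  maximal domains correspond.\<close>

lemma frac_deriv_inverse:
  fixes g u :: "real \<Rightarrow> complex ^ 'n"
  assumes rho: "rho > 0"
  shows "frac_deriv rho gam g u \<longleftrightarrow> frac_deriv rho (- gam) u g"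
proof -
  have "frac_deriv rho (- gam) u g" if "frac_deriv rho gam g u" for gam and g u :: "real \<Rightarrow> complex ^ 'n"
  proof -
    from that obtain h :: "real \<Rightarrow> complex ^ 'n" where h: "\<forall>k. L2_FT (wcomp rho g k) (\<lambda>x. h x $ k) \<and>
      L2_FT (wcomp rho u k) (\<lambda>x. Complex rho x powr of_real gam * h x $ k)"
      unfolding frac_deriv_iff ..
    have inv: "Complex rho x powr of_real (- gam) * (Complex rho x powr of_real gam * z) = z" for x z
      using rho by (simp add: powr_minus complex_eq_iff[of "Complex rho x" 0] flip: mult.assoc)
    show ?thesis
      unfolding frac_deriv_iff
    proof (rule exI[of _ "\<lambda>x. \<chi> k. Complex rho x powr of_real gam * h x $ k"])
      show "\<forall>k. L2_FT (wcomp rho u k) (\<lambda>x. (\<chi> k. Complex rho x powr of_real gam * h x $ k) $ k) \<and>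
        L2_FT (wcomp rho g k) (\<lambda>x. Complex rho x powr of_real (- gam) *
          (\<chi> k. Complex rho x powr of_real gam * h x $ k) $ k)"
        unfolding vec_lambda_beta inv using h by blast
    qed
  qed
  from this[of gam g u] this[of "- gam" u g] show ?thesis by auto
qed

text \<open>Injectivity: inversion turns the difference of G1 and G2, reflected, into a transform of
  zero.\<close>

lemma L2_FT_unique_left:
  assumes 1: "L2_FT G1 H" and 2: "L2_FT G2 H"
  shows "AE t in lborel. G1 t = G2 t"
proof -
  note [measurable] = L2_FT_measurable[OF 1] L2_FT_measurable[OF 2]
  have "L2_FT (\<lambda>x. H x - H x) (\<lambda>t. G1 (- t) - G2 (- t))"
    using L2_FT_diff[OF 1 2] by (subst L2_FT_inverse_iff[of _ "\<lambda>t. G1 t - G2 t"])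
  from L2_FT_energy_le[OF this] have "energy (\<lambda>t. G1 (- t) - G2 (- t)) = 0"
    by (simp add: energy_def)
  then have "energy (\<lambda>t. G1 t - G2 t) = 0"
    using energy_reflect[of "\<lambda>t. G1 t - G2 t"] by simp
  then show ?thesis by (subst (asm) energy_eq_0_iff) auto
qed

lemma frac_deriv_neg_iff_convolve:
  fixes g u :: "real \<Rightarrow> complex ^ 'n"
  assumes alpha: "alpha > 0" and rho: "rho > 0" and g: "L2rho rho g" and u: "u \<in> borel_measurable borel"
  shows "frac_deriv rho (- alpha) g u
    \<longleftrightarrow> (AE t in lborel. \<forall>k. wcomp rho u k t = convolve (frac_kernel rho alpha) (wcomp rho g k) t)"
proof -
  interpret convolution_kernel "frac_kernel rho alpha"
    by (rule convolution_kernel_frac_kernel[OF alpha rho])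
  have wg: "wcomp rho g k \<in> borel_measurable borel" "energy (wcomp rho g k) < \<infinity>" for k
    using g L2rho_iff by blast+
  have conv: "L2_FT (convolve (frac_kernel rho alpha) (wcomp rho g k)) (\<lambda>x. Complex rho x powr of_real (- alpha) * h x)"
    if "L2_FT (wcomp rho g k) h" for k h
    using L2_FT_convolve[OF that] by (simp only: integral_iexp_frac_kernel[OF alpha rho])
  show ?thesis
  proof
    assume "frac_deriv rho (- alpha) g u"
    then obtain h :: "real \<Rightarrow> complex ^ 'n" where "\<forall>k. L2_FT (wcomp rho g k) (\<lambda>x. h x $ k) \<and>
      L2_FT (wcomp rho u k) (\<lambda>x. Complex rho x powr of_real (- alpha) * h x $ k)"
      unfolding frac_deriv_iff ..
    then have h: "L2_FT (wcomp rho g k) (\<lambda>x. h x $ k)"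
      "L2_FT (wcomp rho u k) (\<lambda>x. Complex rho x powr of_real (- alpha) * h x $ k)" for k
      by auto
    show "AE t in lborel. \<forall>k. wcomp rho u k t = convolve (frac_kernel rho alpha) (wcomp rho g k) t"
      by (intro eventually_all_finite L2_FT_unique_left[OF h(2) conv[OF h(1)]])
  next
    assume AE: "AE t in lborel. \<forall>k. wcomp rho u k t = convolve (frac_kernel rho alpha) (wcomp rho g k) t"
    \<comment> \<open>Every component of g has a transform, and the convolution has the multiplied
      one; so the convolution equation by itself puts g into the domain.\<close>
    have "\<forall>k. \<exists>h. L2_FT (wcomp rho g k) h" using L2_FT_exists[OF wg] by blast
    then obtain h where h: "\<And>k. L2_FT (wcomp rho g k) (h k)" by metis
    have "L2_FT (wcomp rho u k) (\<lambda>x. Complex rho x powr of_real (- alpha) * h k x)" for k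
    proof (rule L2_FT_cong_AE[OF conv[OF h]])
      show "wcomp rho u k \<in> borel_measurable borel"
        using u borel_measurable_vec_iff_wcomp by blast
      show "(\<lambda>x. Complex rho x powr of_real (- alpha) * h k x) \<in> borel_measurable borel"
        by (rule L2_FT_measurable(2)[OF conv[OF h]])
      show "AE t in lborel. convolve (frac_kernel rho alpha) (wcomp rho g k) t = wcomp rho u k t"
        using AE by eventually_elim simp
    qed simp
    with h show "frac_deriv rho (- alpha) g u"
      unfolding frac_deriv_iff by (intro exI[of _ "\<lambda>x. \<chi> k. h k x"]) simp
  qed
qed

text \<open>Since exp (- rho (t - s)) exp (- rho s) = exp (- rho t), the weight leaves the integral,
  and convolving weighted functions is the weighted form of the Riemann-Liouville integral.\<close>

lemma frac_kernel_wcomp: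
  "of_real (frac_kernel rho alpha (t - s)) * wcomp rho g k s
    = of_real (exp (- (rho * t)) / Gamma alpha) *
      (indicator {..<t} s *\<^sub>R (of_real ((t - s) powr (alpha - 1)) * g s $ k))"
proof -
  have "exp (- (rho * (t - s))) * exp (- (rho * s)) = exp (- (rho * t))"
    by (simp add: algebra_simps flip: exp_add)
  then have "frac_kernel rho alpha (t - s) * exp (- (rho * s))
      = exp (- (rho * t)) / Gamma alpha * (indicator {..<t} s * (t - s) powr (alpha - 1))"
    by (simp add: frac_kernel_def gamma_weight_def split: split_indicator)
  then have "of_real (frac_kernel rho alpha (t - s)) * wcomp rho g k s
      = of_real (exp (- (rho * t)) / Gamma alpha * (indicator {..<t} s * (t - s) powr (alpha - 1))) * g s $ k"
    by (simp only: wcomp_def mult.assoc[symmetric] of_real_mult[symmetric])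
  then show ?thesis by (simp add: scaleR_conv_of_real)
qed

lemma wcomp_eq_convolve_iff:
  "wcomp rho u k t = convolve (frac_kernel rho alpha) (wcomp rho g k) t
    \<longleftrightarrow> u t $ k = of_real (1 / Gamma alpha) *
        (LINT s:{..<t}|lborel. of_real ((t - s) powr (alpha - 1)) * g s $ k)"
proof -
  have "convolve (frac_kernel rho alpha) (wcomp rho g k) t = of_real (exp (- (rho * t))) *
      (of_real (1 / Gamma alpha) * (LINT s:{..<t}|lborel. of_real ((t - s) powr (alpha - 1)) * g s $ k))"
    unfolding convolve_def frac_kernel_wcomp set_lebesgue_integral_def integral_mult_right_zero by simp
  then show ?thesis
    unfolding wcomp_def[of rho u] by (simp only: mult_cancel_left of_real_eq_0_iff exp_not_eq_zero simp_thms)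
qed

text \<open>Absolute convergence of the convolution, divided by its nonzero prefactor.\<close>

lemma AE_set_integrable_frac_kernel:
  assumes alpha: "alpha > 0" and rho: "rho > 0" and g: "L2rho rho g"
  shows "AE t in lborel. set_integrable lborel {..<t} (\<lambda>s. of_real ((t - s) powr (alpha - 1)) * g s $ k)"
proof -
  interpret convolution_kernel "frac_kernel rho alpha"
    by (rule convolution_kernel_frac_kernel[OF alpha rho])
  have "AE t in lborel. integrable lborel (\<lambda>s. of_real (frac_kernel rho alpha (t - s)) * wcomp rho g k s)"
    using g by (intro AE_integrable_convolve) (auto simp: L2rho_iff)
  then show ?thesis
  proof eventually_elim
    case (elim t)
    define d where "d = complex_of_real (exp (- (rho * t)) / Gamma alpha)"
    have "d \<noteq> 0"
      using less_imp_neq[OF Gamma_real_pos[OF alpha]] by (simp add: d_def)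
    moreover have "integrable lborel (\<lambda>s. 1 / d * (d *
        (indicator {..<t} s *\<^sub>R (of_real ((t - s) powr (alpha - 1)) * g s $ k))))"
      using elim unfolding frac_kernel_wcomp d_def[symmetric] by (rule integrable_mult_right)
    ultimately show ?case
      by (simp add: set_integrable_def mult.assoc[symmetric])
  qed
qed

section \<open>The nonlinearity on L^2_rho and the equivalence\<close>

lemma L2rho_ftilde:
  fixes f :: "real \<Rightarrow> complex ^ 'n \<Rightarrow> complex ^ 'n"
  assumes f_cont: "continuous_on ({0<..} \<times> UNIV) (\<lambda>(t, x). f t x)"
    and f_lip: "\<forall>t>0. \<forall>y1 y2. norm (f t y1 - f t y2) \<le> c * norm (y1 - y2)"
    and f0_L2: "integrable lborel
        (\<lambda>t. indicator {0<..} t * ((norm (f t 0))\<^sup>2 * exp (-2 * rho0 * t)))"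
    and rho: "rho \<ge> rho0"
    and y_L2: "L2rho rho y"
  shows "L2rho rho (\<lambda>t. ftilde f t (y t))"
proof -
  have [measurable]: "y \<in> borel_measurable borel" using y_L2 by (simp add: L2rho_def)
  \<comment> \<open>Continuity is given on an open set only; the extension by zero is still Borel
    and can be composed with the graph map of y.\<close>
  have "(\<lambda>p. indicator ({0<..} \<times> UNIV) p *\<^sub>R (case p of (t, x) \<Rightarrow> f t x)) \<in> borel_measurable borel"
    by (rule borel_measurable_continuous_on_indicator[OF _ f_cont])
      (auto intro!: borel_open open_Times)
  from measurable_compose[OF borel_measurable_Pair this, of "\<lambda>t. t" borel y]
  have "(\<lambda>t. indicator ({0<..} \<times> UNIV) (t, y t) *\<^sub>R f t (y t)) \<in> borel_measurable borel" by simp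
  also have "(\<lambda>t. indicator ({0<..} \<times> UNIV) (t, y t) *\<^sub>R f t (y t)) = (\<lambda>t. ftilde f t (y t))"
    by (auto simp: ftilde_def indicator_def)
  finally have [measurable]: "(\<lambda>t. ftilde f t (y t)) \<in> borel_measurable borel" .
  \<comment> \<open>The majorant comes from comparing f (t, y) with f (t, 0) by the Lipschitz bound
    and |a + b|^2 \<le> 2 |a|^2 + 2 |b|^2.\<close>
  have "integrable lborel (\<lambda>t. 2 * c\<^sup>2 * ((norm (y t))\<^sup>2 * exp (- 2 * rho * t))
      + 2 * (indicator {0<..} t * ((norm (f t 0))\<^sup>2 * exp (-2 * rho0 * t))))"
    using y_L2 f0_L2
    by (intro Bochner_Integration.integrable_add integrable_mult_right) (auto simp: L2rho_def)
  moreover have "(norm (ftilde f t (y t)))\<^sup>2 * exp (- 2 * rho * t)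
      \<le> 2 * c\<^sup>2 * ((norm (y t))\<^sup>2 * exp (- 2 * rho * t))
      + 2 * (indicator {0<..} t * ((norm (f t 0))\<^sup>2 * exp (-2 * rho0 * t)))" for t
  proof (cases "t > 0")
    case True
    have "(norm (f t (y t)))\<^sup>2 \<le> 2 * (norm (f t (y t) - f t 0))\<^sup>2 + 2 * (norm (f t 0))\<^sup>2"
      using norm_power2_sum_le[of "f t (y t) - f t 0" "f t 0"] by simp
    also have "(norm (f t (y t) - f t 0))\<^sup>2 \<le> (c * norm (y t - 0))\<^sup>2"
      using f_lip[rule_format, OF True, of "y t" 0] by (intro power_mono) auto
    finally have "(norm (f t (y t)))\<^sup>2 * exp (- 2 * rho * t)
        \<le> (2 * c\<^sup>2 * (norm (y t))\<^sup>2 + 2 * (norm (f t 0))\<^sup>2) * exp (- 2 * rho * t)"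
      by (intro mult_right_mono) (auto simp: power_mult_distrib)
    \<comment> \<open>Enlarging rho0 to rho shrinks the weight at positive times, the only ones
      where the nonlinearity lives.\<close>
    moreover have "exp (- 2 * rho * t) \<le> exp (- 2 * rho0 * t)"
      using True rho by simp
    then have "(norm (f t 0))\<^sup>2 * exp (- 2 * rho * t) \<le> (norm (f t 0))\<^sup>2 * exp (- 2 * rho0 * t)"
      by (intro mult_left_mono) auto
    ultimately show ?thesis using True by (simp add: ftilde_def algebra_simps)
  qed (simp add: ftilde_def)
  ultimately have "integrable lborel (\<lambda>t. (norm (ftilde f t (y t)))\<^sup>2 * exp (- 2 * rho * t))"
    by (elim Bochner_Integration.integrable_bound) (auto intro: order_trans)
  then show ?thesis by (simp add: L2rho_def)
qed

text \<open>The first condition states integrability together with the equation because a Bochner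
  integral that does not exist has the value 0, so the equation alone would not express
  convergence.\<close>

theorem theorem3p1:
  fixes alpha rho0 rho c :: real
    and y0 :: "complex ^ 'n"
    and f :: "real \<Rightarrow> complex ^ 'n \<Rightarrow> complex ^ 'n"
    and y :: "real \<Rightarrow> complex ^ 'n"
  assumes alpha: "0 < alpha" "alpha \<le> 1"
    and f_cont: "continuous_on ({0<..} \<times> UNIV) (\<lambda>(t, x). f t x)"
    and c_nonneg: "c \<ge> 0"
    and f_lip: "\<forall>t>0. \<forall>y1 y2. norm (f t y1 - f t y2) \<le> c * norm (y1 - y2)"
    and f0_L2: "integrable lborel
        (\<lambda>t. indicator {0<..} t * ((norm (f t 0))\<^sup>2 * exp (-2 * rho0 * t)))"
    and rho: "rho > max 0 rho0"
    and y_L2: "L2rho rho y"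
  shows
   "((AE t in lborel.
        (\<forall>k. set_integrable lborel {..<t}
               (\<lambda>s. complex_of_real ((t - s) powr (alpha - 1)) * ftilde f s (y s) $ k)) \<and>
        y t = cscale (complex_of_real (indicator {0<..} t)) y0 +
          (\<chi> k. complex_of_real (1 / Gamma alpha) *
             (LINT s:{..<t}|lborel. complex_of_real ((t - s) powr (alpha - 1)) * ftilde f s (y s) $ k)))
     \<longleftrightarrow> frac_deriv rho (- alpha) (\<lambda>t. ftilde f t (y t))
           (\<lambda>t. y t - cscale (complex_of_real (indicator {0<..} t)) y0))
    \<and> (frac_deriv rho (- alpha) (\<lambda>t. ftilde f t (y t))
           (\<lambda>t. y t - cscale (complex_of_real (indicator {0<..} t)) y0)
     \<longleftrightarrow> frac_deriv rho alpha (\<lambda>t. y t - cscale (complex_of_real (indicator {0<..} t)) y0)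
           (\<lambda>t. ftilde f t (y t)))"
proof -
  define g where "g t = ftilde f t (y t)" for t
  define u where "u t = y t - cscale (complex_of_real (indicator {0<..} t)) y0" for t
  define I where "I t k = complex_of_real (1 / Gamma alpha) *
      (LINT s:{..<t}|lborel. complex_of_real ((t - s) powr (alpha - 1)) * g s $ k)" for t k
  have rho0: "rho > 0" using rho by simp
  have g: "L2rho rho g"
    unfolding g_def by (rule L2rho_ftilde[OF f_cont f_lip f0_L2 _ y_L2]) (use rho in simp)
  have u: "u \<in> borel_measurable borel"
  proof -
    have [measurable]: "(\<lambda>t. y t $ k) \<in> borel_measurable borel" for k
      using y_L2 borel_measurable_vec_iff[of y lborel] by (simp add: L2rho_def)
    show ?thesis
      unfolding borel_measurable_vec_iff[of u] by (simp add: u_def cscale_def)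
  qed
  \<comment> \<open>Young's inequality settles the convergence for almost every t, so that the
    equation is what remains to be compared.\<close>
  have int: "AE t in lborel. \<forall>k. set_integrable lborel {..<t}
      (\<lambda>s. complex_of_real ((t - s) powr (alpha - 1)) * g s $ k)"
    by (intro eventually_all_finite AE_set_integrable_frac_kernel[OF alpha(1) rho0 g])
  have "y t = cscale (complex_of_real (indicator {0<..} t)) y0 + (\<chi> k. I t k) \<longleftrightarrow> (\<forall>k. u t $ k = I t k)" for t
    by (auto simp: vec_eq_iff u_def algebra_simps)
  then have "(AE t in lborel.
        (\<forall>k. set_integrable lborel {..<t} (\<lambda>s. complex_of_real ((t - s) powr (alpha - 1)) * g s $ k)) \<and>
        y t = cscale (complex_of_real (indicator {0<..} t)) y0 + (\<chi> k. I t k))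
      \<longleftrightarrow> (AE t in lborel. \<forall>k. u t $ k = I t k)"
    using int by (simp add: AE_conj_iff)
  also have "\<dots> \<longleftrightarrow> frac_deriv rho (- alpha) g u"
    unfolding frac_deriv_neg_iff_convolve[OF alpha(1) rho0 g u] wcomp_eq_convolve_iff I_def ..
  finally show ?thesis
    using frac_deriv_inverse[OF rho0, of "- alpha" g u] unfolding I_def u_def[abs_def] g_def[abs_def] by simp
qed

end
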